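(* Let $I$ be the pullback shape category $\{\bullet\to\bullet\leftarrow\bullet\}$. Let $\mathcal{A}$ be the $2$-category generated by objects $X,L,A,B,C$; morphisms $f\colon X\to L$, $\lambda_0\colon L\to B$, $\lambda_1\colon L\to C$, $\alpha_0\colon X\to B$, $\alpha_1\colon X\to C$, $b\colon B\to A$, $c\colon C\to A$; and $2$-morphisms $\gamma_0\colon\lambda_0 f\Rightarrow\alpha_0$ and $\gamma_1\colon\lambda_1 f\Rightarrow\alpha_1$; subject to the relations $b\lambda_0=c\lambda_1$ and $b\alpha_0=c\alpha_1$. Let $F\colon I\to\mathcal{A}$ be the diagram $B\xrightarrow{b}A\xleftarrow{c}C$, and let $\lambda\colon\Delta L\Rightarrow F$ be the cone with components $\lambda_0$ at $B$, $\lambda_1$ at $C$ and $b\lambda_0=c\lambda_1$ at $A$ (with identity $2$-morphism components). Then, since there are no (non-identity) invertible $2$-morphisms in $\mathcal{A}$, $(L,\lambda)$ is also an example of a $2$-terminal object in the lax-slice of pseudo-cones over $F$ that is not a pseudo-limit of $F$.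
   Context: $2$-categories and $2$-functors are strict; $*$ denotes horizontal composition (and whiskering) of $2$-morphisms and juxtaposition denotes vertical composition. "Generated by the data subject to relations" means the $2$-category freely generated by the listed objects, morphisms and $2$-morphisms, modulo the listed relations. The $1$-category $I$ is regarded as a $2$-category with only identity $2$-morphisms. A pseudo-natural transformation $\mu\colon F\Rightarrow G$ between $2$-functors $F,G\colon I\to\mathcal{A}$ consists of morphisms $\mu_i\colon Fi\to Gi$ for $i\in I$ and invertible $2$-morphisms $\mu_f\colon(Gf)\mu_i\Rightarrow\mu_j(Ff)$ for $f\colon i\to j$ in $I$, such that $\mu_{\mathrm{id}_i}=\mathrm{id}_{\mu_i}$, $\mu_{gf}=(\mu_g*Ff)(Gg*\mu_f)$ for composable $f,g$, and $\mu_g(G\alpha*\mu_i)=(\mu_j*F\alpha)\mu_f$ for every $2$-morphism $\alpha\colon f\Rightarrow g$ in $I$. A modification $\varphi\colon\mu\to\nu$ consists of $2$-morphisms $\varphi_i\colon\mu_i\Rightarrow\nu_i$ with $\nu_f(Gf*\varphi_i)=(\varphi_j*Ff)\mu_f$ for every $f\colon i\to j$. $\mathrm{Ps}[I,\mathcal{A}]$ is the $2$-category of $2$-functors, pseudo-natural transformations and modifications. $\Delta X$ is the constant $2$-functor at $X$; a pseudo-cone over $F$ is a pseudo-natural transformation $\Delta X\Rightarrow F$. A pseudo-limit of $F$ is a pair $(L,\lambda\colon\Delta L\Rightarrow F)$ with $\lambda$ a pseudo-cone such that for each $X\in\mathcal{A}$ the functor $\lambda_*\circ\Delta\colon\mathcal{A}(X,L)\to\mathrm{Ps}[I,\mathcal{A}](\Delta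 X,F)$, given by post-composition with $\lambda$, is an isomorphism of categories. The lax-slice of pseudo-cones over $F$ is the $2$-category whose objects are pairs $(X,\mu)$ with $\mu\colon\Delta X\Rightarrow F$ a pseudo-cone; morphisms $(X,\mu)\to(Y,\nu)$ are pairs $(f,\varphi)$ of a morphism $f\colon X\to Y$ in $\mathcal{A}$ and a modification $\varphi\colon\nu\Delta f\to\mu$; $2$-morphisms $(f,\varphi)\Rightarrow(g,\psi)$ are $2$-morphisms $\alpha\colon f\Rightarrow g$ in $\mathcal{A}$ with $\psi(\nu*\Delta\alpha)=\varphi$. An object $L$ of a $2$-category $\mathcal{B}$ is $2$-terminal if for all $X\in\mathcal{B}$ the category $\mathcal{B}(X,L)$ is isomorphic to the terminal category $\mathbb{1}$.
   Formalization: The relation b∗γ₀ = c∗γ₁ is added to the presentation of 𝒜; without it b∗γ₀ ≠ c∗γ₁, so there is no modification λΔf → α, hence no morphism (X,α) → (L,λ) in the lax-slice, and (L,λ) is not 2-terminal. *)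

theory Defs
  imports "HOL-Library.FuncSet"
begin

section \<open>Categories, functors and isomorphisms of categories\<close>

record ('a, 'b) cat =
  cobj :: "'a set"
  carr :: "'b set"
  cdom :: "'b \<Rightarrow> 'a"
  ccod :: "'b \<Rightarrow> 'a"
  cid :: "'a \<Rightarrow> 'b"
  ccomp :: "'b \<Rightarrow> 'b \<Rightarrow> 'b"  \<comment> \<open>\<open>ccomp C g f\<close> is \<open>g\<close> after \<open>f\<close>; likewise for all compositions below\<close>

definition car :: "('a, 'b) cat \<Rightarrow> 'b \<Rightarrow> 'a \<Rightarrow> 'a \<Rightarrow> bool" where
  "car C f x y \<longleftrightarrow> f \<in> carr C \<and> cdom C f = x \<and> ccod C f = y \<and> x \<in> cobj C \<and> y \<in> cobj C"

locale category =
  fixes C :: "('a, 'b) cat"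
  assumes arr: "f \<in> carr C \<Longrightarrow> car C f (cdom C f) (ccod C f)"
    and id_arr: "x \<in> cobj C \<Longrightarrow> car C (cid C x) x x"
    and comp_arr: "car C f x y \<Longrightarrow> car C g y z \<Longrightarrow> car C (ccomp C g f) x z"
    and comp_id: "car C f x y \<Longrightarrow> ccomp C f (cid C x) = f"
    and id_comp: "car C f x y \<Longrightarrow> ccomp C (cid C y) f = f"
    and comp_assoc: "car C f x y \<Longrightarrow> car C g y z \<Longrightarrow> car C h z w \<Longrightarrow>
      ccomp C h (ccomp C g f) = ccomp C (ccomp C h g) f"

locale cat_functor = C: category C + D: category D
  for C :: "('a, 'b) cat" and D :: "('a2, 'b2) cat" +
  fixes F0 :: "'a \<Rightarrow> 'a2" and F1 :: "'b \<Rightarrow> 'b2"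
  assumes map_obj: "x \<in> cobj C \<Longrightarrow> F0 x \<in> cobj D"
    and map_arr: "car C f x y \<Longrightarrow> car D (F1 f) (F0 x) (F0 y)"
    and map_id: "x \<in> cobj C \<Longrightarrow> F1 (cid C x) = cid D (F0 x)"
    and map_comp: "car C f x y \<Longrightarrow> car C g y z \<Longrightarrow> F1 (ccomp C g f) = ccomp D (F1 g) (F1 f)"

definition cat_iso ::
  "('a, 'b) cat \<Rightarrow> ('a2, 'b2) cat \<Rightarrow> ('a \<Rightarrow> 'a2) \<Rightarrow> ('b \<Rightarrow> 'b2) \<Rightarrow> bool" where
  "cat_iso C D F0 F1 \<longleftrightarrow> cat_functor C D F0 F1 \<and>
     (\<exists>G0 G1. cat_functor D C G0 G1 \<and>
        (\<forall>x \<in> cobj C. G0 (F0 x) = x) \<and> (\<forall>f \<in> carr C. G1 (F1 f) = f) \<and>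
        (\<forall>y \<in> cobj D. F0 (G0 y) = y) \<and> (\<forall>g \<in> carr D. F1 (G1 g) = g))"

definition isomorphic_cats :: "('a, 'b) cat \<Rightarrow> ('a2, 'b2) cat \<Rightarrow> bool" where
  "isomorphic_cats C D \<longleftrightarrow> (\<exists>F0 F1. cat_iso C D F0 F1)"

definition terminal_cat :: "(unit, unit) cat" where
  "terminal_cat = \<lparr> cobj = UNIV, carr = UNIV, cdom = (\<lambda>_. ()), ccod = (\<lambda>_. ()),
     cid = (\<lambda>_. ()), ccomp = (\<lambda>_ _. ()) \<rparr>"


section \<open>Strict 2-categories\<close>

record ('o, 'm, 'c) two_cat =
  Ob :: "'o set"
  Mo :: "'m set"
  Ce :: "'c set"
  src :: "'m \<Rightarrow> 'o"
  trg :: "'m \<Rightarrow> 'o"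
  dom2 :: "'c \<Rightarrow> 'm"
  cod2 :: "'c \<Rightarrow> 'm"
  id1 :: "'o \<Rightarrow> 'm"
  id2 :: "'m \<Rightarrow> 'c"
  comp1 :: "'m \<Rightarrow> 'm \<Rightarrow> 'm" (infixr "\<cdot>\<index>" 75)
  vcomp :: "'c \<Rightarrow> 'c \<Rightarrow> 'c" (infixr "\<odot>\<index>" 70)
  hcomp :: "'c \<Rightarrow> 'c \<Rightarrow> 'c" (infixr "\<star>\<index>" 75)

definition mor :: "('o, 'm, 'c) two_cat \<Rightarrow> 'm \<Rightarrow> 'o \<Rightarrow> 'o \<Rightarrow> bool" where
  "mor A f x y \<longleftrightarrow> f \<in> Mo A \<and> src A f = x \<and> trg A f = y \<and> x \<in> Ob A \<and> y \<in> Ob A"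

definition cell :: "('o, 'm, 'c) two_cat \<Rightarrow> 'c \<Rightarrow> 'm \<Rightarrow> 'm \<Rightarrow> bool" where
  "cell A \<alpha> f g \<longleftrightarrow> \<alpha> \<in> Ce A \<and> dom2 A \<alpha> = f \<and> cod2 A \<alpha> = g \<and>
     mor A f (src A f) (trg A f) \<and> mor A g (src A f) (trg A f)"

locale two_category =
  fixes A :: "('o, 'm, 'c) two_cat" (structure)
  assumes mor: "f \<in> Mo A \<Longrightarrow> mor A f (src A f) (trg A f)"
    and cell: "\<alpha> \<in> Ce A \<Longrightarrow> cell A \<alpha> (dom2 A \<alpha>) (cod2 A \<alpha>)"
    \<comment> \<open>the underlying category\<close>
    and id1_mor: "x \<in> Ob A \<Longrightarrow> mor A (id1 A x) x x"
    and comp1_mor: "mor A f x y \<Longrightarrow> mor A g y z \<Longrightarrow> mor A (g \<cdot> f) x z"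
    and comp1_id1: "mor A f x y \<Longrightarrow> f \<cdot> id1 A x = f"
    and id1_comp1: "mor A f x y \<Longrightarrow> id1 A y \<cdot> f = f"
    and comp1_assoc: "mor A f x y \<Longrightarrow> mor A g y z \<Longrightarrow> mor A h z w \<Longrightarrow> h \<cdot> (g \<cdot> f) = (h \<cdot> g) \<cdot> f"
    \<comment> \<open>the hom-categories\<close>
    and id2_cell: "f \<in> Mo A \<Longrightarrow> cell A (id2 A f) f f"
    and vcomp_cell: "cell A \<alpha> f g \<Longrightarrow> cell A \<beta> g h \<Longrightarrow> cell A (\<beta> \<odot> \<alpha>) f h"
    and vcomp_id2: "cell A \<alpha> f g \<Longrightarrow> \<alpha> \<odot> id2 A f = \<alpha>"
    and id2_vcomp: "cell A \<alpha> f g \<Longrightarrow> id2 A g \<odot> \<alpha> = \<alpha>"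
    and vcomp_assoc: "cell A \<alpha> f g \<Longrightarrow> cell A \<beta> g h \<Longrightarrow> cell A \<gamma> h k \<Longrightarrow>
      \<gamma> \<odot> (\<beta> \<odot> \<alpha>) = (\<gamma> \<odot> \<beta>) \<odot> \<alpha>"
    \<comment> \<open>horizontal composition\<close>
    and hcomp_cell: "cell A \<alpha> f f' \<Longrightarrow> cell A \<beta> g g' \<Longrightarrow> src A g = trg A f \<Longrightarrow>
      cell A (\<beta> \<star> \<alpha>) (g \<cdot> f) (g' \<cdot> f')"
    and hcomp_id: "cell A \<alpha> f f' \<Longrightarrow> \<alpha> \<star> id2 A (id1 A (src A f)) = \<alpha>"
    and id_hcomp: "cell A \<alpha> f f' \<Longrightarrow> id2 A (id1 A (trg A f)) \<star> \<alpha> = \<alpha>"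
    and hcomp_assoc: "cell A \<alpha> f f' \<Longrightarrow> cell A \<beta> g g' \<Longrightarrow> cell A \<gamma> h h' \<Longrightarrow>
      src A g = trg A f \<Longrightarrow> src A h = trg A g \<Longrightarrow> \<gamma> \<star> (\<beta> \<star> \<alpha>) = (\<gamma> \<star> \<beta>) \<star> \<alpha>"
    and hcomp_id2: "mor A f x y \<Longrightarrow> mor A g y z \<Longrightarrow> id2 A g \<star> id2 A f = id2 A (g \<cdot> f)"
    and interchange: "cell A \<alpha> f f' \<Longrightarrow> cell A \<alpha>' f' f'' \<Longrightarrow> cell A \<beta> g g' \<Longrightarrow> cell A \<beta>' g' g'' \<Longrightarrow>
      src A g = trg A f \<Longrightarrow> (\<beta>' \<odot> \<beta>) \<star> (\<alpha>' \<odot> \<alpha>) = (\<beta>' \<star> \<alpha>') \<odot> (\<beta> \<star> \<alpha>)"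

definition lwhisk :: "('o, 'm, 'c) two_cat \<Rightarrow> 'm \<Rightarrow> 'c \<Rightarrow> 'c" where
  "lwhisk A g \<alpha> = hcomp A (id2 A g) \<alpha>"

definition rwhisk :: "('o, 'm, 'c) two_cat \<Rightarrow> 'c \<Rightarrow> 'm \<Rightarrow> 'c" where
  "rwhisk A \<alpha> f = hcomp A \<alpha> (id2 A f)"

definition invertible2 :: "('o, 'm, 'c) two_cat \<Rightarrow> 'c \<Rightarrow> bool" where
  "invertible2 A \<alpha> \<longleftrightarrow> \<alpha> \<in> Ce A \<and>
     (\<exists>\<beta>. cell A \<beta> (cod2 A \<alpha>) (dom2 A \<alpha>) \<and>
        vcomp A \<beta> \<alpha> = id2 A (dom2 A \<alpha>) \<and> vcomp A \<alpha> \<beta> = id2 A (cod2 A \<alpha>))"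

definition hom_cat :: "('o, 'm, 'c) two_cat \<Rightarrow> 'o \<Rightarrow> 'o \<Rightarrow> ('m, 'c) cat" where
  "hom_cat A x y = \<lparr> cobj = {f. mor A f x y},
     carr = {\<alpha> \<in> Ce A. mor A (dom2 A \<alpha>) x y \<and> mor A (cod2 A \<alpha>) x y},
     cdom = dom2 A, ccod = cod2 A, cid = id2 A, ccomp = vcomp A \<rparr>"

definition two_terminal :: "('o, 'm, 'c) two_cat \<Rightarrow> 'o \<Rightarrow> bool" where
  "two_terminal B L \<longleftrightarrow> L \<in> Ob B \<and>
     (\<forall>X \<in> Ob B. isomorphic_cats (hom_cat B X L) terminal_cat)"

text \<open>A category regarded as a 2-category with only identity 2-morphisms: the 2-morphism
  \<open>id\<^sub>f\<close> is represented by \<open>f\<close> itself.\<close>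

definition locally_discrete :: "('o, 'm) cat \<Rightarrow> ('o, 'm, 'm) two_cat" where
  "locally_discrete C = \<lparr> Ob = cobj C, Mo = carr C, Ce = carr C, src = cdom C, trg = ccod C,
     dom2 = (\<lambda>f. f), cod2 = (\<lambda>f. f), id1 = cid C, id2 = (\<lambda>f. f),
     comp1 = ccomp C, vcomp = (\<lambda>g f. f), hcomp = ccomp C \<rparr>"


section \<open>2-functors, pseudo-natural transformations and modifications\<close>

text \<open>The component maps are required to be \<open>extensional\<close> (that is, \<open>undefined\<close> outside the
  carriers of the indexing 2-category), so that equality of records is equality of
  2-functors, transformations and modifications.\<close>

record ('io, 'im, 'ic, 'o, 'm, 'c) two_fun =
  fob :: "'io \<Rightarrow> 'o"
  fmo :: "'im \<Rightarrow> 'm"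
  fce :: "'ic \<Rightarrow> 'c"

locale two_functor = I: two_category I + A: two_category A
  for I :: "('io, 'im, 'ic) two_cat" and A :: "('o, 'm, 'c) two_cat" +
  fixes F :: "('io, 'im, 'ic, 'o, 'm, 'c) two_fun"
  assumes extensional: "fob F \<in> extensional (Ob I)" "fmo F \<in> extensional (Mo I)"
      "fce F \<in> extensional (Ce I)"
    and fob: "i \<in> Ob I \<Longrightarrow> fob F i \<in> Ob A"
    and fmo: "mor I u i j \<Longrightarrow> mor A (fmo F u) (fob F i) (fob F j)"
    and fce: "cell I s u v \<Longrightarrow> cell A (fce F s) (fmo F u) (fmo F v)"
    and fmo_id1: "i \<in> Ob I \<Longrightarrow> fmo F (id1 I i) = id1 A (fob F i)"
    and fmo_comp1: "mor I u i j \<Longrightarrow> mor I v j k \<Longrightarrow>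
      fmo F (comp1 I v u) = comp1 A (fmo F v) (fmo F u)"
    and fce_id2: "u \<in> Mo I \<Longrightarrow> fce F (id2 I u) = id2 A (fmo F u)"
    and fce_vcomp: "cell I s u v \<Longrightarrow> cell I t v w \<Longrightarrow>
      fce F (vcomp I t s) = vcomp A (fce F t) (fce F s)"
    and fce_hcomp: "cell I s u u' \<Longrightarrow> cell I t v v' \<Longrightarrow> src I v = trg I u \<Longrightarrow>
      fce F (hcomp I t s) = hcomp A (fce F t) (fce F s)"

record ('io, 'im, 'ic, 'o, 'm, 'c) ptrans =
  psrc :: "('io, 'im, 'ic, 'o, 'm, 'c) two_fun"
  ptrg :: "('io, 'im, 'ic, 'o, 'm, 'c) two_fun"
  pob :: "'io \<Rightarrow> 'm"
  pmo :: "'im \<Rightarrow> 'c"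

locale pseudonatural =
  F: two_functor I A "psrc \<mu>" + G: two_functor I A "ptrg \<mu>"
  for I :: "('io, 'im, 'ic) two_cat" and A :: "('o, 'm, 'c) two_cat"
    and \<mu> :: "('io, 'im, 'ic, 'o, 'm, 'c) ptrans" +
  assumes extensional: "pob \<mu> \<in> extensional (Ob I)" "pmo \<mu> \<in> extensional (Mo I)"
    and pob: "i \<in> Ob I \<Longrightarrow> mor A (pob \<mu> i) (fob (psrc \<mu>) i) (fob (ptrg \<mu>) i)"
    and pmo: "mor I u i j \<Longrightarrow>
      cell A (pmo \<mu> u) (comp1 A (fmo (ptrg \<mu>) u) (pob \<mu> i)) (comp1 A (pob \<mu> j) (fmo (psrc \<mu>) u))"
    and pmo_invertible: "u \<in> Mo I \<Longrightarrow> invertible2 A (pmo \<mu> u)"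
    and pmo_id1: "i \<in> Ob I \<Longrightarrow> pmo \<mu> (id1 I i) = id2 A (pob \<mu> i)"
    and pmo_comp1: "mor I u i j \<Longrightarrow> mor I v j k \<Longrightarrow>
      pmo \<mu> (comp1 I v u) =
        vcomp A (rwhisk A (pmo \<mu> v) (fmo (psrc \<mu>) u)) (lwhisk A (fmo (ptrg \<mu>) v) (pmo \<mu> u))"
    and pmo_natural: "mor I u i j \<Longrightarrow> mor I v i j \<Longrightarrow> cell I s u v \<Longrightarrow>
      vcomp A (pmo \<mu> v) (rwhisk A (fce (ptrg \<mu>) s) (pob \<mu> i)) =
      vcomp A (lwhisk A (pob \<mu> j) (fce (psrc \<mu>) s)) (pmo \<mu> u)"

record ('io, 'im, 'ic, 'o, 'm, 'c) modif =
  msrc :: "('io, 'im, 'ic, 'o, 'm, 'c) ptrans"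
  mtrg :: "('io, 'im, 'ic, 'o, 'm, 'c) ptrans"
  mob :: "'io \<Rightarrow> 'c"

locale modification =
  S: pseudonatural I A "msrc \<phi>" + T: pseudonatural I A "mtrg \<phi>"
  for I :: "('io, 'im, 'ic) two_cat" and A :: "('o, 'm, 'c) two_cat"
    and \<phi> :: "('io, 'im, 'ic, 'o, 'm, 'c) modif" +
  assumes parallel: "psrc (mtrg \<phi>) = psrc (msrc \<phi>)" "ptrg (mtrg \<phi>) = ptrg (msrc \<phi>)"
    and extensional: "mob \<phi> \<in> extensional (Ob I)"
    and mob: "i \<in> Ob I \<Longrightarrow> cell A (mob \<phi> i) (pob (msrc \<phi>) i) (pob (mtrg \<phi>) i)"
    and mob_natural: "mor I u i j \<Longrightarrow>
      vcomp A (pmo (mtrg \<phi>) u) (lwhisk A (fmo (ptrg (msrc \<phi>)) u) (mob \<phi> i)) =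
      vcomp A (rwhisk A (mob \<phi> j) (fmo (psrc (msrc \<phi>)) u)) (pmo (msrc \<phi>) u)"

definition ptrans_comp ::
  "('io, 'im, 'ic) two_cat \<Rightarrow> ('o, 'm, 'c) two_cat \<Rightarrow> ('io, 'im, 'ic, 'o, 'm, 'c) ptrans \<Rightarrow>
     ('io, 'im, 'ic, 'o, 'm, 'c) ptrans \<Rightarrow> ('io, 'im, 'ic, 'o, 'm, 'c) ptrans" where
  "ptrans_comp I A \<nu> \<mu> = \<lparr> psrc = psrc \<mu>, ptrg = ptrg \<nu>,
     pob = (\<lambda>i \<in> Ob I. comp1 A (pob \<nu> i) (pob \<mu> i)),
     pmo = (\<lambda>u \<in> Mo I. vcomp A (lwhisk A (pob \<nu> (trg I u)) (pmo \<mu> u))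
                              (rwhisk A (pmo \<nu> u) (pob \<mu> (src I u)))) \<rparr>"

text \<open>The 2-category \<open>Ps[I, A]\<close>.\<close>

definition Ps :: "('io, 'im, 'ic) two_cat \<Rightarrow> ('o, 'm, 'c) two_cat \<Rightarrow>
    (('io, 'im, 'ic, 'o, 'm, 'c) two_fun, ('io, 'im, 'ic, 'o, 'm, 'c) ptrans,
     ('io, 'im, 'ic, 'o, 'm, 'c) modif) two_cat" where
  "Ps I A = \<lparr>
     Ob = {F. two_functor I A F},
     Mo = {\<mu>. pseudonatural I A \<mu>},
     Ce = {\<phi>. modification I A \<phi>},
     src = psrc, trg = ptrg, dom2 = msrc, cod2 = mtrg,
     id1 = (\<lambda>F. \<lparr> psrc = F, ptrg = F,
       pob = (\<lambda>i \<in> Ob I. id1 A (fob F i)), pmo = (\<lambda>u \<in> Mo I. id2 A (fmo F u)) \<rparr>),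
     id2 = (\<lambda>\<mu>. \<lparr> msrc = \<mu>, mtrg = \<mu>, mob = (\<lambda>i \<in> Ob I. id2 A (pob \<mu> i)) \<rparr>),
     comp1 = ptrans_comp I A,
     vcomp = (\<lambda>\<psi> \<phi>. \<lparr> msrc = msrc \<phi>, mtrg = mtrg \<psi>,
       mob = (\<lambda>i \<in> Ob I. vcomp A (mob \<psi> i) (mob \<phi> i)) \<rparr>),
     hcomp = (\<lambda>\<psi> \<phi>. \<lparr>
       msrc = ptrans_comp I A (msrc \<psi>) (msrc \<phi>), mtrg = ptrans_comp I A (mtrg \<psi>) (mtrg \<phi>),
       mob = (\<lambda>i \<in> Ob I. hcomp A (mob \<psi> i) (mob \<phi> i)) \<rparr>) \<rparr>"


section \<open>Pseudo-cones, pseudo-limits and the lax-slice\<close>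

definition Delta_ob :: "('io, 'im, 'ic) two_cat \<Rightarrow> ('o, 'm, 'c) two_cat \<Rightarrow> 'o \<Rightarrow>
    ('io, 'im, 'ic, 'o, 'm, 'c) two_fun" where
  "Delta_ob I A X = \<lparr> fob = (\<lambda>i \<in> Ob I. X), fmo = (\<lambda>u \<in> Mo I. id1 A X),
     fce = (\<lambda>s \<in> Ce I. id2 A (id1 A X)) \<rparr>"

definition Delta_mor :: "('io, 'im, 'ic) two_cat \<Rightarrow> ('o, 'm, 'c) two_cat \<Rightarrow> 'm \<Rightarrow>
    ('io, 'im, 'ic, 'o, 'm, 'c) ptrans" where
  "Delta_mor I A f = \<lparr> psrc = Delta_ob I A (src A f), ptrg = Delta_ob I A (trg A f),
     pob = (\<lambda>i \<in> Ob I. f), pmo = (\<lambda>u \<in> Mo I. id2 A f) \<rparr>"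

definition Delta_cell :: "('io, 'im, 'ic) two_cat \<Rightarrow> ('o, 'm, 'c) two_cat \<Rightarrow> 'c \<Rightarrow>
    ('io, 'im, 'ic, 'o, 'm, 'c) modif" where
  "Delta_cell I A \<alpha> = \<lparr> msrc = Delta_mor I A (dom2 A \<alpha>), mtrg = Delta_mor I A (cod2 A \<alpha>),
     mob = (\<lambda>i \<in> Ob I. \<alpha>) \<rparr>"

definition pseudo_cone :: "('io, 'im, 'ic) two_cat \<Rightarrow> ('o, 'm, 'c) two_cat \<Rightarrow>
    ('io, 'im, 'ic, 'o, 'm, 'c) two_fun \<Rightarrow> 'o \<Rightarrow> ('io, 'im, 'ic, 'o, 'm, 'c) ptrans \<Rightarrow> bool" where
  "pseudo_cone I A F X \<mu> \<longleftrightarrow> X \<in> Ob A \<and> mor (Ps I A) \<mu> (Delta_ob I A X) F"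

definition pseudo_limit :: "('io, 'im, 'ic) two_cat \<Rightarrow> ('o, 'm, 'c) two_cat \<Rightarrow>
    ('io, 'im, 'ic, 'o, 'm, 'c) two_fun \<Rightarrow> 'o \<Rightarrow> ('io, 'im, 'ic, 'o, 'm, 'c) ptrans \<Rightarrow> bool" where
  "pseudo_limit I A F L l \<longleftrightarrow> pseudo_cone I A F L l \<and>
     (\<forall>X \<in> Ob A. cat_iso (hom_cat A X L) (hom_cat (Ps I A) (Delta_ob I A X) F)
        (\<lambda>f. comp1 (Ps I A) l (Delta_mor I A f))
        (\<lambda>\<alpha>. lwhisk (Ps I A) l (Delta_cell I A \<alpha>)))"

record ('io, 'im, 'ic, 'o, 'm, 'c) lax_mor =
  lsrc :: "'o \<times> ('io, 'im, 'ic, 'o, 'm, 'c) ptrans"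
  ltrg :: "'o \<times> ('io, 'im, 'ic, 'o, 'm, 'c) ptrans"
  lmo :: 'm
  lmod :: "('io, 'im, 'ic, 'o, 'm, 'c) modif"

record ('io, 'im, 'ic, 'o, 'm, 'c) lax_cell =
  ldom :: "('io, 'im, 'ic, 'o, 'm, 'c) lax_mor"
  lcod :: "('io, 'im, 'ic, 'o, 'm, 'c) lax_mor"
  lce :: 'c

definition lax_slice_mor :: "('io, 'im, 'ic) two_cat \<Rightarrow> ('o, 'm, 'c) two_cat \<Rightarrow>
    ('io, 'im, 'ic, 'o, 'm, 'c) two_fun \<Rightarrow> ('io, 'im, 'ic, 'o, 'm, 'c) lax_mor \<Rightarrow> bool" where
  "lax_slice_mor I A F p \<longleftrightarrow>
     pseudo_cone I A F (fst (lsrc p)) (snd (lsrc p)) \<and>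
     pseudo_cone I A F (fst (ltrg p)) (snd (ltrg p)) \<and>
     mor A (lmo p) (fst (lsrc p)) (fst (ltrg p)) \<and>
     cell (Ps I A) (lmod p)
       (comp1 (Ps I A) (snd (ltrg p)) (Delta_mor I A (lmo p))) (snd (lsrc p))"

definition lax_slice_cell :: "('io, 'im, 'ic) two_cat \<Rightarrow> ('o, 'm, 'c) two_cat \<Rightarrow>
    ('io, 'im, 'ic, 'o, 'm, 'c) two_fun \<Rightarrow> ('io, 'im, 'ic, 'o, 'm, 'c) lax_cell \<Rightarrow> bool" where
  "lax_slice_cell I A F \<theta> \<longleftrightarrow>
     lax_slice_mor I A F (ldom \<theta>) \<and> lax_slice_mor I A F (lcod \<theta>) \<and>
     lsrc (lcod \<theta>) = lsrc (ldom \<theta>) \<and> ltrg (lcod \<theta>) = ltrg (ldom \<theta>) \<and>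
     cell A (lce \<theta>) (lmo (ldom \<theta>)) (lmo (lcod \<theta>)) \<and>
     vcomp (Ps I A) (lmod (lcod \<theta>))
       (lwhisk (Ps I A) (snd (ltrg (ldom \<theta>))) (Delta_cell I A (lce \<theta>))) = lmod (ldom \<theta>)"

definition lax_mor_comp :: "('io, 'im, 'ic) two_cat \<Rightarrow> ('o, 'm, 'c) two_cat \<Rightarrow>
    ('io, 'im, 'ic, 'o, 'm, 'c) lax_mor \<Rightarrow> ('io, 'im, 'ic, 'o, 'm, 'c) lax_mor \<Rightarrow>
    ('io, 'im, 'ic, 'o, 'm, 'c) lax_mor" where
  "lax_mor_comp I A q p = \<lparr> lsrc = lsrc p, ltrg = ltrg q, lmo = comp1 A (lmo q) (lmo p),
     lmod = vcomp (Ps I A) (lmod p) (rwhisk (Ps I A) (lmod q) (Delta_mor I A (lmo p))) \<rparr>"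

definition lax_slice :: "('io, 'im, 'ic) two_cat \<Rightarrow> ('o, 'm, 'c) two_cat \<Rightarrow>
    ('io, 'im, 'ic, 'o, 'm, 'c) two_fun \<Rightarrow>
    ('o \<times> ('io, 'im, 'ic, 'o, 'm, 'c) ptrans, ('io, 'im, 'ic, 'o, 'm, 'c) lax_mor,
     ('io, 'im, 'ic, 'o, 'm, 'c) lax_cell) two_cat" where
  "lax_slice I A F = \<lparr>
     Ob = {(X, \<mu>). pseudo_cone I A F X \<mu>},
     Mo = {p. lax_slice_mor I A F p},
     Ce = {\<theta>. lax_slice_cell I A F \<theta>},
     src = lsrc, trg = ltrg, dom2 = ldom, cod2 = lcod,
     id1 = (\<lambda>x. \<lparr> lsrc = x, ltrg = x, lmo = id1 A (fst x), lmod = id2 (Ps I A) (snd x) \<rparr>),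
     id2 = (\<lambda>p. \<lparr> ldom = p, lcod = p, lce = id2 A (lmo p) \<rparr>),
     comp1 = lax_mor_comp I A,
     vcomp = (\<lambda>\<beta> \<alpha>. \<lparr> ldom = ldom \<alpha>, lcod = lcod \<beta>, lce = vcomp A (lce \<beta>) (lce \<alpha>) \<rparr>),
     hcomp = (\<lambda>\<beta> \<alpha>. \<lparr> ldom = lax_mor_comp I A (ldom \<beta>) (ldom \<alpha>),
       lcod = lax_mor_comp I A (lcod \<beta>) (lcod \<alpha>), lce = hcomp A (lce \<beta>) (lce \<alpha>) \<rparr>) \<rparr>"


section \<open>2-categories presented by generators and relations\<close>

text \<open>The elements of \<open>'o\<close>, \<open>'g\<close> and \<open>'h\<close> are the generating objects, morphisms and
  2-morphisms. Morphisms and 2-morphisms of the presented 2-category are classes of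
  well-formed formal composites modulo the congruence generated by the axioms of a strict
  2-category and the relations. The relations are supposed to relate parallel well-formed terms.\<close>

datatype ('o, 'g) tm1 =
    Id1 'o
  | Gen1 'g
  | Comp1 "('o, 'g) tm1" "('o, 'g) tm1"

datatype ('o, 'g, 'h) tm2 =
    Id2 "('o, 'g) tm1"
  | Gen2 'h
  | VComp "('o, 'g, 'h) tm2" "('o, 'g, 'h) tm2"
  | HComp "('o, 'g, 'h) tm2" "('o, 'g, 'h) tm2"

record ('o, 'g, 'h) presentation =
  gsrc :: "'g \<Rightarrow> 'o"
  gtrg :: "'g \<Rightarrow> 'o"
  gdom :: "'h \<Rightarrow> ('o, 'g) tm1"
  gcod :: "'h \<Rightarrow> ('o, 'g) tm1"
  rel1 :: "(('o, 'g) tm1 \<times> ('o, 'g) tm1) set"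
  rel2 :: "(('o, 'g, 'h) tm2 \<times> ('o, 'g, 'h) tm2) set"

fun tsrc :: "('o, 'g, 'h) presentation \<Rightarrow> ('o, 'g) tm1 \<Rightarrow> 'o" where
  "tsrc P (Id1 x) = x"
| "tsrc P (Gen1 g) = gsrc P g"
| "tsrc P (Comp1 v u) = tsrc P u"

fun ttrg :: "('o, 'g, 'h) presentation \<Rightarrow> ('o, 'g) tm1 \<Rightarrow> 'o" where
  "ttrg P (Id1 x) = x"
| "ttrg P (Gen1 g) = gtrg P g"
| "ttrg P (Comp1 v u) = ttrg P v"

fun wf1 :: "('o, 'g, 'h) presentation \<Rightarrow> ('o, 'g) tm1 \<Rightarrow> bool" where
  "wf1 P (Id1 x) = True"
| "wf1 P (Gen1 g) = True"
| "wf1 P (Comp1 v u) = (wf1 P v \<and> wf1 P u \<and> tsrc P v = ttrg P u)"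

inductive eq1 :: "('o, 'g, 'h) presentation \<Rightarrow> ('o, 'g) tm1 \<Rightarrow> ('o, 'g) tm1 \<Rightarrow> bool"
  for P where
  refl: "wf1 P u \<Longrightarrow> eq1 P u u"
| sym: "eq1 P u v \<Longrightarrow> eq1 P v u"
| trans: "eq1 P u v \<Longrightarrow> eq1 P v w \<Longrightarrow> eq1 P u w"
| cong: "eq1 P u u' \<Longrightarrow> eq1 P v v' \<Longrightarrow> wf1 P (Comp1 v u) \<Longrightarrow> eq1 P (Comp1 v u) (Comp1 v' u')"
| comp_id: "wf1 P u \<Longrightarrow> eq1 P (Comp1 u (Id1 (tsrc P u))) u"
| id_comp: "wf1 P u \<Longrightarrow> eq1 P (Comp1 (Id1 (ttrg P u)) u) u"
| assoc: "wf1 P (Comp1 w (Comp1 v u)) \<Longrightarrow> eq1 P (Comp1 w (Comp1 v u)) (Comp1 (Comp1 w v) u)"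
| rel: "(u, v) \<in> rel1 P \<Longrightarrow> eq1 P u v"

fun tdom :: "('o, 'g, 'h) presentation \<Rightarrow> ('o, 'g, 'h) tm2 \<Rightarrow> ('o, 'g) tm1" where
  "tdom P (Id2 u) = u"
| "tdom P (Gen2 h) = gdom P h"
| "tdom P (VComp t s) = tdom P s"
| "tdom P (HComp t s) = Comp1 (tdom P t) (tdom P s)"

fun tcod :: "('o, 'g, 'h) presentation \<Rightarrow> ('o, 'g, 'h) tm2 \<Rightarrow> ('o, 'g) tm1" where
  "tcod P (Id2 u) = u"
| "tcod P (Gen2 h) = gcod P h"
| "tcod P (VComp t s) = tcod P t"
| "tcod P (HComp t s) = Comp1 (tcod P t) (tcod P s)"

text \<open>Vertical composability is up to the congruence on 1-terms.\<close>

fun wf2 :: "('o, 'g, 'h) presentation \<Rightarrow> ('o, 'g, 'h) tm2 \<Rightarrow> bool" where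
  "wf2 P (Id2 u) = wf1 P u"
| "wf2 P (Gen2 h) = True"
| "wf2 P (VComp t s) = (wf2 P t \<and> wf2 P s \<and> eq1 P (tdom P t) (tcod P s))"
| "wf2 P (HComp t s) = (wf2 P t \<and> wf2 P s \<and> tsrc P (tdom P t) = ttrg P (tdom P s))"

inductive eq2 :: "('o, 'g, 'h) presentation \<Rightarrow> ('o, 'g, 'h) tm2 \<Rightarrow> ('o, 'g, 'h) tm2 \<Rightarrow> bool"
  for P where
  refl: "wf2 P s \<Longrightarrow> eq2 P s s"
| sym: "eq2 P s t \<Longrightarrow> eq2 P t s"
| trans: "eq2 P s t \<Longrightarrow> eq2 P t r \<Longrightarrow> eq2 P s r"
| id2_cong: "eq1 P u v \<Longrightarrow> eq2 P (Id2 u) (Id2 v)"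
| vcong: "eq2 P s s' \<Longrightarrow> eq2 P t t' \<Longrightarrow> wf2 P (VComp t s) \<Longrightarrow> eq2 P (VComp t s) (VComp t' s')"
| hcong: "eq2 P s s' \<Longrightarrow> eq2 P t t' \<Longrightarrow> wf2 P (HComp t s) \<Longrightarrow> eq2 P (HComp t s) (HComp t' s')"
| vcomp_id: "wf2 P s \<Longrightarrow> eq2 P (VComp s (Id2 (tdom P s))) s"
| id_vcomp: "wf2 P s \<Longrightarrow> eq2 P (VComp (Id2 (tcod P s)) s) s"
| vassoc: "wf2 P (VComp r (VComp t s)) \<Longrightarrow>
    eq2 P (VComp r (VComp t s)) (VComp (VComp r t) s)"
| hcomp_id: "wf2 P s \<Longrightarrow> eq2 P (HComp s (Id2 (Id1 (tsrc P (tdom P s))))) s"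
| id_hcomp: "wf2 P s \<Longrightarrow> eq2 P (HComp (Id2 (Id1 (ttrg P (tdom P s)))) s) s"
| hassoc: "wf2 P (HComp r (HComp t s)) \<Longrightarrow>
    eq2 P (HComp r (HComp t s)) (HComp (HComp r t) s)"
| hcomp_id2: "wf1 P (Comp1 v u) \<Longrightarrow> eq2 P (HComp (Id2 v) (Id2 u)) (Id2 (Comp1 v u))"
| interchange: "wf2 P (HComp (VComp t' t) (VComp s' s)) \<Longrightarrow>
    eq2 P (HComp (VComp t' t) (VComp s' s)) (VComp (HComp t' s') (HComp t s))"
| rel: "(s, t) \<in> rel2 P \<Longrightarrow> eq2 P s t"

definition cls1 :: "('o, 'g, 'h) presentation \<Rightarrow> ('o, 'g) tm1 \<Rightarrow> ('o, 'g) tm1 set" where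
  "cls1 P u = {v. eq1 P u v}"

definition cls2 :: "('o, 'g, 'h) presentation \<Rightarrow> ('o, 'g, 'h) tm2 \<Rightarrow> ('o, 'g, 'h) tm2 set" where
  "cls2 P s = {t. eq2 P s t}"

definition rep :: "'t set \<Rightarrow> 't" where
  "rep M = (SOME t. t \<in> M)"

definition presented :: "('o, 'g, 'h) presentation \<Rightarrow>
    ('o, ('o, 'g) tm1 set, ('o, 'g, 'h) tm2 set) two_cat" where
  "presented P = \<lparr>
     Ob = UNIV,
     Mo = cls1 P ` {u. wf1 P u},
     Ce = cls2 P ` {s. wf2 P s},
     src = (\<lambda>M. tsrc P (rep M)),
     trg = (\<lambda>M. ttrg P (rep M)),
     dom2 = (\<lambda>S. cls1 P (tdom P (rep S))),
     cod2 = (\<lambda>S. cls1 P (tcod P (rep S))),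
     id1 = (\<lambda>x. cls1 P (Id1 x)),
     id2 = (\<lambda>M. cls2 P (Id2 (rep M))),
     comp1 = (\<lambda>N M. cls1 P (Comp1 (rep N) (rep M))),
     vcomp = (\<lambda>T S. cls2 P (VComp (rep T) (rep S))),
     hcomp = (\<lambda>T S. cls2 P (HComp (rep T) (rep S))) \<rparr>"


section \<open>The pullback shape and the example\<close>

datatype cospan_ob = Left | Mid | Right

datatype cospan_mor = Ident cospan_ob | LeftMid | RightMid

fun cospan_dom :: "cospan_mor \<Rightarrow> cospan_ob" where
  "cospan_dom (Ident i) = i"
| "cospan_dom LeftMid = Left"
| "cospan_dom RightMid = Right"

fun cospan_cod :: "cospan_mor \<Rightarrow> cospan_ob" where
  "cospan_cod (Ident i) = i"
| "cospan_cod LeftMid = Mid"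
| "cospan_cod RightMid = Mid"

definition cospan_cat :: "(cospan_ob, cospan_mor) cat" where
  "cospan_cat = \<lparr> cobj = UNIV, carr = UNIV, cdom = cospan_dom, ccod = cospan_cod, cid = Ident,
     ccomp = (\<lambda>v u. case u of Ident _ \<Rightarrow> v | _ \<Rightarrow> u) \<rparr>"

definition cospan :: "(cospan_ob, cospan_mor, cospan_mor) two_cat" where
  "cospan = locally_discrete cospan_cat"

datatype ex_ob = oX | oL | oA | oB | oC

datatype ex_mor = mf | lambda0 | lambda1 | alpha0 | alpha1 | mb | mc

datatype ex_cell = gamma0 | gamma1

fun ex_src :: "ex_mor \<Rightarrow> ex_ob" where
  "ex_src mf = oX"
| "ex_src lambda0 = oL"
| "ex_src lambda1 = oL"
| "ex_src alpha0 = oX"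
| "ex_src alpha1 = oX"
| "ex_src mb = oB"
| "ex_src mc = oC"

fun ex_trg :: "ex_mor \<Rightarrow> ex_ob" where
  "ex_trg mf = oL"
| "ex_trg lambda0 = oB"
| "ex_trg lambda1 = oC"
| "ex_trg alpha0 = oB"
| "ex_trg alpha1 = oC"
| "ex_trg mb = oA"
| "ex_trg mc = oA"

fun ex_dom :: "ex_cell \<Rightarrow> (ex_ob, ex_mor) tm1" where
  "ex_dom gamma0 = Comp1 (Gen1 lambda0) (Gen1 mf)"
| "ex_dom gamma1 = Comp1 (Gen1 lambda1) (Gen1 mf)"

fun ex_cod :: "ex_cell \<Rightarrow> (ex_ob, ex_mor) tm1" where
  "ex_cod gamma0 = Gen1 alpha0"
| "ex_cod gamma1 = Gen1 alpha1"

text \<open>In addition to \<open>b \<lambda>\<^sub>0 = c \<lambda>\<^sub>1\<close> and \<open>b \<alpha>\<^sub>0 = c \<alpha>\<^sub>1\<close>, the relation \<open>b * \<gamma>\<^sub>0 = c * \<gamma>\<^sub>1\<close> between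
  2-morphisms is imposed. It does not follow from the other two, and it says that \<open>\<gamma>\<^sub>0\<close> and \<open>\<gamma>\<^sub>1\<close>
  are the components of a modification from \<open>\<lambda> \<Delta>f\<close> to the cone \<open>\<alpha>\<close>. Without it there is no
  such modification, hence no morphism from \<open>(X, \<alpha>)\<close> to \<open>(L, \<lambda>)\<close> in the lax-slice, and \<open>(L, \<lambda>)\<close>
  is not 2-terminal there.\<close>

definition ex_pres :: "(ex_ob, ex_mor, ex_cell) presentation" where
  "ex_pres = \<lparr> gsrc = ex_src, gtrg = ex_trg, gdom = ex_dom, gcod = ex_cod,
     rel1 = {(Comp1 (Gen1 mb) (Gen1 lambda0), Comp1 (Gen1 mc) (Gen1 lambda1)),
             (Comp1 (Gen1 mb) (Gen1 alpha0), Comp1 (Gen1 mc) (Gen1 alpha1))},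
     rel2 = {(HComp (Id2 (Gen1 mb)) (Gen2 gamma0), HComp (Id2 (Gen1 mc)) (Gen2 gamma1))} \<rparr>"

definition ex_two_cat ::
  "(ex_ob, (ex_ob, ex_mor) tm1 set, (ex_ob, ex_mor, ex_cell) tm2 set) two_cat" where
  "ex_two_cat = presented ex_pres"

abbreviation gen :: "ex_mor \<Rightarrow> (ex_ob, ex_mor) tm1 set" where
  "gen g \<equiv> cls1 ex_pres (Gen1 g)"

fun ex_fob :: "cospan_ob \<Rightarrow> ex_ob" where
  "ex_fob Left = oB"
| "ex_fob Mid = oA"
| "ex_fob Right = oC"

fun ex_fmo :: "cospan_mor \<Rightarrow> (ex_ob, ex_mor) tm1 set" where
  "ex_fmo (Ident i) = id1 ex_two_cat (ex_fob i)"
| "ex_fmo LeftMid = gen mb"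
| "ex_fmo RightMid = gen mc"

definition ex_diagram :: "(cospan_ob, cospan_mor, cospan_mor, ex_ob, (ex_ob, ex_mor) tm1 set,
    (ex_ob, ex_mor, ex_cell) tm2 set) two_fun" where
  "ex_diagram = \<lparr> fob = ex_fob, fmo = ex_fmo, fce = (\<lambda>u. id2 ex_two_cat (ex_fmo u)) \<rparr>"

fun ex_leg :: "cospan_ob \<Rightarrow> (ex_ob, ex_mor) tm1 set" where
  "ex_leg Left = gen lambda0"
| "ex_leg Mid = comp1 ex_two_cat (gen mb) (gen lambda0)"
| "ex_leg Right = gen lambda1"

definition ex_cone :: "(cospan_ob, cospan_mor, cospan_mor, ex_ob, (ex_ob, ex_mor) tm1 set,
    (ex_ob, ex_mor, ex_cell) tm2 set) ptrans" where
  "ex_cone = \<lparr> psrc = Delta_ob cospan ex_two_cat oL, ptrg = ex_diagram, pob = ex_leg,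
     pmo = (\<lambda>u. id2 ex_two_cat (ex_leg (cospan_cod u))) \<rparr>"

end

theory Submission
  imports Defs
begin

text \<open>A morphism of \<open>\<A>\<close> is determined by its source, its target and whether \<open>f\<close> occurs in it, and
  parallel 2-morphisms with equal source and target coincide; the non-identity ones are \<open>\<gamma>\<^sub>0\<close>,
  \<open>\<gamma>\<^sub>1\<close> and \<open>b * \<gamma>\<^sub>0\<close>, each of which removes the occurrence of \<open>f\<close> and so is not invertible. Hence
  the only pseudo-cones over the diagram are \<open>\<lambda>\<close>, \<open>\<lambda> \<Delta>f\<close> and \<open>\<alpha>\<close>, and each of them has exactly
  one morphism to \<open>\<lambda>\<close> in the lax-slice, whose modification is respectively the identity, the
  identity and \<open>(\<gamma>\<^sub>0, b * \<gamma>\<^sub>0, \<gamma>\<^sub>1)\<close>. But \<open>\<alpha>\<close> does not factor strictly through \<open>\<lambda>\<close>, since \<open>f\<close> is the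
  only morphism from \<open>X\<close> to \<open>L\<close>.\<close>

section \<open>Presented 2-categories\<close>

text \<open>Makes explicit the parallelism that \<open>presented\<close> takes for granted. For
  2-relations the boundaries need agree only up to \<open>eq1\<close>: those of
  \<open>b * \<gamma>\<^sub>0\<close> and \<open>c * \<gamma>\<^sub>1\<close> are different terms
  for the same morphisms.\<close>

locale wf_presentation =
  fixes P :: "('o, 'g, 'h) presentation"
  assumes gen2_wf: "wf1 P (gdom P h)" "wf1 P (gcod P h)"
    and gen2_parallel: "tsrc P (gcod P h) = tsrc P (gdom P h)" "ttrg P (gcod P h) = ttrg P (gdom P h)"
    and rel1_parallel: "(u, v) \<in> rel1 P \<Longrightarrow> wf1 P u \<and> wf1 P v \<and> tsrc P u = tsrc P v \<and> ttrg P u = ttrg P v"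
    and rel2_parallel: "(s, t) \<in> rel2 P \<Longrightarrow>
      wf2 P s \<and> wf2 P t \<and> eq1 P (tdom P s) (tdom P t) \<and> eq1 P (tcod P s) (tcod P t)"
begin

lemma eq1_parallel:
  "eq1 P u v \<Longrightarrow> wf1 P u \<and> wf1 P v \<and> tsrc P u = tsrc P v \<and> ttrg P u = ttrg P v"
  by (induction rule: eq1.induct) (auto dest: rel1_parallel)

lemma wf2_boundary:
  "wf2 P s \<Longrightarrow> wf1 P (tdom P s) \<and> wf1 P (tcod P s) \<and>
    tsrc P (tcod P s) = tsrc P (tdom P s) \<and> ttrg P (tcod P s) = ttrg P (tdom P s)"
  by (induction s) (auto simp: gen2_wf gen2_parallel dest: eq1_parallel)

text \<open>Boundaries are preserved only up to \<open>eq1\<close>, because rules such as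
  \<open>hassoc\<close> and \<open>hcomp_id\<close> rebracket them or add an identity. This is what
  makes \<open>dom2\<close> and \<open>cod2\<close> well defined on classes.\<close>

lemma eq2_parallel:
  "eq2 P s t \<Longrightarrow> wf2 P s \<and> wf2 P t \<and> eq1 P (tdom P s) (tdom P t) \<and> eq1 P (tcod P s) (tcod P t)"
proof (induction rule: eq2.induct)
  case (vcong s s' t t')
  then show ?case by (auto intro: eq1.sym eq1.trans)
next
  case (hcong s s' t t')
  then show ?case
    using wf2_boundary eq1_parallel by (auto intro!: eq1.cong dest: eq1_parallel wf2_boundary)
next
  case (interchange t' t s' s)
  then show ?case
    using wf2_boundary[of s] wf2_boundary[of t] wf2_boundary[of s'] wf2_boundary[of t']
      eq1_parallel[of "tdom P t'" "tcod P t"] eq1_parallel[of "tdom P s'" "tcod P s"]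
    by (auto intro!: eq1.refl eq1.cong)
next
  case (hassoc r t s)
  then show ?case
    using wf2_boundary[of s] wf2_boundary[of t] wf2_boundary[of r]
    by (auto intro!: eq1.assoc)
next
  case (hcomp_id s)
  then show ?case
    using eq1.comp_id[of P "tdom P s"] eq1.comp_id[of P "tcod P s"] wf2_boundary[of s] by auto
next
  case (id_hcomp s)
  then show ?case
    using eq1.id_comp[of P "tdom P s"] eq1.id_comp[of P "tcod P s"] wf2_boundary[of s] by auto
qed (auto intro: eq1.intros dest: wf2_boundary eq1_parallel rel2_parallel)

section \<open>Congruence classes and their representatives\<close>

lemma cls1_eq: "wf1 P u \<Longrightarrow> cls1 P u = cls1 P v \<longleftrightarrow> eq1 P u v"
  unfolding cls1_def by (blast intro: eq1.intros)

lemma cls2_eq: "wf2 P s \<Longrightarrow> cls2 P s = cls2 P t \<longleftrightarrow> eq2 P s t"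
  unfolding cls2_def by (blast intro: eq2.intros)

lemma cls1_eqI: "eq1 P u v \<Longrightarrow> cls1 P v = cls1 P u"
  using cls1_eq eq1_parallel by metis

lemma cls2_eqI: "eq2 P s t \<Longrightarrow> cls2 P t = cls2 P s"
  using cls2_eq eq2_parallel by metis

lemma rep_cls1: "wf1 P u \<Longrightarrow> eq1 P u (rep (cls1 P u))"
  unfolding rep_def cls1_def by (rule someI2[of _ u]) (auto intro: eq1.refl)

lemma rep_cls2: "wf2 P s \<Longrightarrow> eq2 P s (rep (cls2 P s))"
  unfolding rep_def cls2_def by (rule someI2[of _ s]) (auto intro: eq2.refl)

text \<open>The chosen representative is congruent to \<open>u\<close>, and congruent terms are
  parallel, so any representative may be used. The lemmas that follow do the same for the other
  operations.\<close>

lemma src_cls1: "wf1 P u \<Longrightarrow> src (presented P) (cls1 P u) = tsrc P u"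
  and trg_cls1: "wf1 P u \<Longrightarrow> trg (presented P) (cls1 P u) = ttrg P u"
  using rep_cls1[of u] eq1_parallel by (auto simp: presented_def)

lemma dom2_cls2: "wf2 P s \<Longrightarrow> dom2 (presented P) (cls2 P s) = cls1 P (tdom P s)"
  and cod2_cls2: "wf2 P s \<Longrightarrow> cod2 (presented P) (cls2 P s) = cls1 P (tcod P s)"
  using eq2_parallel[OF rep_cls2, of s] by (simp_all add: presented_def cls1_eqI)

lemma id1_presented: "id1 (presented P) x = cls1 P (Id1 x)"
  by (simp add: presented_def)

lemma id2_cls1: "wf1 P u \<Longrightarrow> id2 (presented P) (cls1 P u) = cls2 P (Id2 u)"
  using rep_cls1[of u] by (simp add: presented_def cls2_eqI eq2.id2_cong)

lemma comp1_cls1: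
  "wf1 P (Comp1 v u) \<Longrightarrow> comp1 (presented P) (cls1 P v) (cls1 P u) = cls1 P (Comp1 v u)"
  using rep_cls1[of u] rep_cls1[of v] by (simp add: presented_def cls1_eqI eq1.cong)

lemma vcomp_cls2:
  "wf2 P (VComp t s) \<Longrightarrow> vcomp (presented P) (cls2 P t) (cls2 P s) = cls2 P (VComp t s)"
  using rep_cls2[of s] rep_cls2[of t] by (simp add: presented_def cls2_eqI eq2.vcong)

lemma hcomp_cls2:
  "wf2 P (HComp t s) \<Longrightarrow> hcomp (presented P) (cls2 P t) (cls2 P s) = cls2 P (HComp t s)"
  using rep_cls2[of s] rep_cls2[of t] by (simp add: presented_def cls2_eqI eq2.hcong)

lemma Ob_presented: "Ob (presented P) = UNIV"
  by (simp add: presented_def)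

lemma mor_presented:
  "mor (presented P) M x y \<longleftrightarrow> (\<exists>u. wf1 P u \<and> M = cls1 P u \<and> tsrc P u = x \<and> ttrg P u = y)"
proof -
  have "M \<in> Mo (presented P) \<longleftrightarrow> (\<exists>u. wf1 P u \<and> M = cls1 P u)"
    by (auto simp: presented_def)
  then show ?thesis
    unfolding mor_def by (auto simp: src_cls1 trg_cls1 Ob_presented)
qed

lemma Mo_presented: "M \<in> Mo (presented P) \<longleftrightarrow> (\<exists>u. wf1 P u \<and> M = cls1 P u)"
  by (auto simp: presented_def)

lemma Ce_presented: "S \<in> Ce (presented P) \<longleftrightarrow> (\<exists>s. wf2 P s \<and> S = cls2 P s)"
  by (auto simp: presented_def)

lemma cell_presented:
  "cell (presented P) S M N \<longleftrightarrow>
    (\<exists>s. wf2 P s \<and> S = cls2 P s \<and> M = cls1 P (tdom P s) \<and> N = cls1 P (tcod P s))"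
  unfolding cell_def Ce_presented mor_presented
  by (auto simp: dom2_cls2 cod2_cls2 src_cls1 trg_cls1 wf2_boundary)
    (metis wf2_boundary src_cls1 trg_cls1)+

text \<open>Each equation is a rule of \<open>eq1\<close> or \<open>eq2\<close> read on classes.
  What has to be shown is that composable classes have composable terms as representatives.\<close>

lemma two_category_presented: "two_category (presented P)"
proof -
  note wfs = wf2_boundary src_cls1 trg_cls1 cls1_eq
  note ops = id1_presented id2_cls1 comp1_cls1 vcomp_cls2 hcomp_cls2
  show ?thesis
  proof
    show "mor (presented P) f (src (presented P) f) (trg (presented P) f)"
      if "f \<in> Mo (presented P)" for f
      using that by (auto simp: Mo_presented mor_presented src_cls1 trg_cls1)
    show "cell (presented P) \<alpha> (dom2 (presented P) \<alpha>) (cod2 (presented P) \<alpha>)"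
      if "\<alpha> \<in> Ce (presented P)" for \<alpha>
      using that by (auto simp: Ce_presented cell_presented dom2_cls2 cod2_cls2)
    show "mor (presented P) (id1 (presented P) x) x x" for x
      by (auto simp: mor_presented id1_presented intro!: exI[of _ "Id1 x"])
    show "mor (presented P) (comp1 (presented P) g f) x z"
      if "mor (presented P) f x y" "mor (presented P) g y z" for f g x y z
    proof -
      from that obtain u v where "wf1 P u" "f = cls1 P u" "tsrc P u = x" "ttrg P u = y"
        "wf1 P v" "g = cls1 P v" "tsrc P v = y" "ttrg P v = z"
        by (auto simp: mor_presented)
      then show ?thesis
        by (auto simp: mor_presented comp1_cls1 intro!: exI[of _ "Comp1 v u"])
    qed
    \<comment> \<open>Classes are sets; without \<open>equalityI\<close> the goal stays an equality
      of classes, which \<open>cls1_eq\<close> turns into a congruence.\<close>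
    show "comp1 (presented P) f (id1 (presented P) x) = f"
      if "mor (presented P) f x y" for f x y
      using that by (auto simp: mor_presented ops cls1_eq intro: eq1.intros del: equalityI)
    show "comp1 (presented P) (id1 (presented P) y) f = f"
      if "mor (presented P) f x y" for f x y
      using that by (auto simp: mor_presented ops cls1_eq intro: eq1.intros del: equalityI)
    show "comp1 (presented P) h (comp1 (presented P) g f) =
        comp1 (presented P) (comp1 (presented P) h g) f"
      if "mor (presented P) f x y" "mor (presented P) g y z" "mor (presented P) h z w"
      for f g h x y z w
      using that by (auto simp: mor_presented ops cls1_eq intro!: eq1.assoc del: equalityI)
    show "cell (presented P) (id2 (presented P) f) f f" if "f \<in> Mo (presented P)" for f
    proof -
      from that obtain u where "wf1 P u" "f = cls1 P u" by (auto simp: Mo_presented)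
      then show ?thesis by (auto simp: cell_presented ops intro!: exI[of _ "Id2 u"])
    qed
    show "cell (presented P) (vcomp (presented P) \<beta> \<alpha>) f h"
      if "cell (presented P) \<alpha> f g" "cell (presented P) \<beta> g h" for \<alpha> \<beta> f g h
    proof -
      from that obtain s t where st: "wf2 P s" "\<alpha> = cls2 P s" "f = cls1 P (tdom P s)"
        "g = cls1 P (tcod P s)" "wf2 P t" "\<beta> = cls2 P t" "g = cls1 P (tdom P t)"
        "h = cls1 P (tcod P t)"
        by (auto simp: cell_presented)
      \<comment> \<open>Both terms represent \<open>g\<close>; their congruence is exactly the
        vertical composability in \<open>wf2\<close>.\<close>
      then have "eq1 P (tdom P t) (tcod P s)" by (metis cls1_eq wf2_boundary)
      with st show ?thesis by (auto simp: cell_presented ops intro!: exI[of _ "VComp t s"])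
    qed
    show "vcomp (presented P) \<alpha> (id2 (presented P) f) = \<alpha>"
      if "cell (presented P) \<alpha> f g" for \<alpha> f g
      using that
      by (auto simp: cell_presented ops cls2_eq wf2_boundary eq1.refl intro: eq2.vcomp_id del: equalityI)
    show "vcomp (presented P) (id2 (presented P) g) \<alpha> = \<alpha>"
      if "cell (presented P) \<alpha> f g" for \<alpha> f g
      using that
      by (auto simp: cell_presented ops cls2_eq wf2_boundary eq1.refl intro: eq2.id_vcomp del: equalityI)
    show "vcomp (presented P) \<gamma> (vcomp (presented P) \<beta> \<alpha>) =
        vcomp (presented P) (vcomp (presented P) \<gamma> \<beta>) \<alpha>"
      if "cell (presented P) \<alpha> f g" "cell (presented P) \<beta> g h" "cell (presented P) \<gamma> h k"
      for \<alpha> \<beta> \<gamma> f g h k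
    proof -
      from that obtain s t r where st: "wf2 P s" "\<alpha> = cls2 P s"
        "g = cls1 P (tcod P s)" "wf2 P t" "\<beta> = cls2 P t" "g = cls1 P (tdom P t)"
        "h = cls1 P (tcod P t)" "wf2 P r" "\<gamma> = cls2 P r" "h = cls1 P (tdom P r)"
        by (auto simp: cell_presented)
      then have "eq1 P (tdom P t) (tcod P s)" "eq1 P (tdom P r) (tcod P t)"
        by (metis cls1_eq wf2_boundary)+
      with st show ?thesis by (auto simp: ops cls2_eq intro!: eq2.vassoc del: equalityI)
    qed
    show "cell (presented P) (hcomp (presented P) \<beta> \<alpha>)
        (comp1 (presented P) g f) (comp1 (presented P) g' f')"
      if "cell (presented P) \<alpha> f f'" "cell (presented P) \<beta> g g'"
        "src (presented P) g = trg (presented P) f" for \<alpha> \<beta> f f' g g'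
    proof -
      from that obtain s t where st: "wf2 P s" "\<alpha> = cls2 P s" "f = cls1 P (tdom P s)"
        "f' = cls1 P (tcod P s)" "wf2 P t" "\<beta> = cls2 P t" "g = cls1 P (tdom P t)"
        "g' = cls1 P (tcod P t)"
        by (auto simp: cell_presented)
      then have "tsrc P (tdom P t) = ttrg P (tdom P s)"
        using that(3) by (simp add: wfs)
      with st show ?thesis
        by (auto simp: cell_presented ops wf2_boundary intro!: exI[of _ "HComp t s"])
    qed
    show "hcomp (presented P) \<alpha> (id2 (presented P) (id1 (presented P) (src (presented P) f))) = \<alpha>"
      if "cell (presented P) \<alpha> f f'" for \<alpha> f f'
      using that
      by (auto simp: cell_presented ops cls2_eq src_cls1 wf2_boundary intro: eq2.hcomp_id del: equalityI)
    show "hcomp (presented P) (id2 (presented P) (id1 (presented P) (trg (presented P) f))) \<alpha> = \<alpha>"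
      if "cell (presented P) \<alpha> f f'" for \<alpha> f f'
      using that
      by (auto simp: cell_presented ops cls2_eq trg_cls1 wf2_boundary intro: eq2.id_hcomp del: equalityI)
    show "hcomp (presented P) \<gamma> (hcomp (presented P) \<beta> \<alpha>) =
        hcomp (presented P) (hcomp (presented P) \<gamma> \<beta>) \<alpha>"
      if "cell (presented P) \<alpha> f f'" "cell (presented P) \<beta> g g'" "cell (presented P) \<gamma> h h'"
        "src (presented P) g = trg (presented P) f" "src (presented P) h = trg (presented P) g"
      for \<alpha> \<beta> \<gamma> f f' g g' h h'
      using that
      by (auto simp: cell_presented ops cls2_eq src_cls1 trg_cls1 wf2_boundary intro!: eq2.hassoc del: equalityI)
    show "hcomp (presented P) (id2 (presented P) g) (id2 (presented P) f) =
        id2 (presented P) (comp1 (presented P) g f)"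
      if "mor (presented P) f x y" "mor (presented P) g y z" for f g x y z
      using that by (auto simp: mor_presented ops cls2_eq intro!: eq2.hcomp_id2 del: equalityI)
    show "hcomp (presented P) (vcomp (presented P) \<beta>' \<beta>) (vcomp (presented P) \<alpha>' \<alpha>) =
        vcomp (presented P) (hcomp (presented P) \<beta>' \<alpha>') (hcomp (presented P) \<beta> \<alpha>)"
      if "cell (presented P) \<alpha> f f'" "cell (presented P) \<alpha>' f' f''"
        "cell (presented P) \<beta> g g'" "cell (presented P) \<beta>' g' g''"
        "src (presented P) g = trg (presented P) f"
      for \<alpha> \<alpha>' \<beta> \<beta>' f f' f'' g g' g''
    proof -
      from that obtain s s' t t' where st: "wf2 P s" "\<alpha> = cls2 P s" "f = cls1 P (tdom P s)"
        "f' = cls1 P (tcod P s)" "wf2 P s'" "\<alpha>' = cls2 P s'" "f' = cls1 P (tdom P s')"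
        "wf2 P t" "\<beta> = cls2 P t" "g = cls1 P (tdom P t)"
        "g' = cls1 P (tcod P t)" "wf2 P t'" "\<beta>' = cls2 P t'" "g' = cls1 P (tdom P t')"
        by (auto simp: cell_presented)
      then have e: "eq1 P (tdom P t') (tcod P t)" "eq1 P (tdom P s') (tcod P s)"
        by (metis cls1_eq wf2_boundary)+
      moreover have c: "tsrc P (tdom P t) = ttrg P (tdom P s)"
        using that(5) st by (simp add: wfs)
      moreover have c': "tsrc P (tdom P t') = ttrg P (tdom P s')"
        using e c st(1,8) by (metis eq1_parallel wf2_boundary)
      \<comment> \<open>The right-hand side of interchange must be well formed too before
        \<open>vcomp_cls2\<close> can compute it; its factors are composable by congruence in each
        argument.\<close>
      ultimately have "wf2 P (VComp (HComp t' s') (HComp t s))"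
        using st(1,5,8,12) wf2_boundary[of s] wf2_boundary[of t] wf2_boundary[of s']
          wf2_boundary[of t']
        by (auto intro!: eq1.cong)
      with st e c c' show ?thesis
        by (simp add: ops cls2_eq eq2.interchange)
    qed
  qed
qed

end


section \<open>Normal forms in the example\<close>

interpretation ex: wf_presentation ex_pres
proof
  fix h show "wf1 ex_pres (gdom ex_pres h)" "wf1 ex_pres (gcod ex_pres h)"
    "tsrc ex_pres (gcod ex_pres h) = tsrc ex_pres (gdom ex_pres h)"
    "ttrg ex_pres (gcod ex_pres h) = ttrg ex_pres (gdom ex_pres h)"
    by (cases h; simp add: ex_pres_def)+
next
  fix u v assume "(u, v) \<in> rel1 ex_pres"
  then show "wf1 ex_pres u \<and> wf1 ex_pres v \<and> tsrc ex_pres u = tsrc ex_pres v \<and>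
    ttrg ex_pres u = ttrg ex_pres v"
    by (auto simp: ex_pres_def)
next
  fix s t assume st: "(s, t) \<in> rel2 ex_pres"
  \<comment> \<open>The domains of the two sides of the 2-relation are joined by rebracketing around
    the square for \<lambda>; their codomains are joined by the square for \<alpha>.\<close>
  have "eq1 ex_pres (Comp1 (Gen1 mb) (Comp1 (Gen1 lambda0) (Gen1 mf)))
    (Comp1 (Comp1 (Gen1 mb) (Gen1 lambda0)) (Gen1 mf))"
    by (rule eq1.assoc) (simp add: ex_pres_def)
  also have "eq1 ex_pres (Comp1 (Comp1 (Gen1 mb) (Gen1 lambda0)) (Gen1 mf))
    (Comp1 (Comp1 (Gen1 mc) (Gen1 lambda1)) (Gen1 mf))"
    by (rule eq1.cong[OF eq1.refl eq1.rel]) (auto simp: ex_pres_def)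
  also (eq1.trans) have "eq1 ex_pres (Comp1 (Comp1 (Gen1 mc) (Gen1 lambda1)) (Gen1 mf))
    (Comp1 (Gen1 mc) (Comp1 (Gen1 lambda1) (Gen1 mf)))"
    by (rule eq1.sym[OF eq1.assoc]) (simp add: ex_pres_def)
  finally (eq1.trans) have "eq1 ex_pres (Comp1 (Gen1 mb) (Comp1 (Gen1 lambda0) (Gen1 mf)))
    (Comp1 (Gen1 mc) (Comp1 (Gen1 lambda1) (Gen1 mf)))"
    .
  with st show "wf2 ex_pres s \<and> wf2 ex_pres t \<and> eq1 ex_pres (tdom ex_pres s) (tdom ex_pres t) \<and>
    eq1 ex_pres (tcod ex_pres s) (tcod ex_pres t)"
    by (auto simp: ex_pres_def intro: eq1.rel)
qed

interpretation E: two_category ex_two_cat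
  unfolding ex_two_cat_def by (rule ex.two_category_presented)

lemma ex_pres_simps [simp]:
  "gsrc ex_pres = ex_src" "gtrg ex_pres = ex_trg" "gdom ex_pres = ex_dom" "gcod ex_pres = ex_cod"
  by (simp_all add: ex_pres_def)

text \<open>\<open>uses_f\<close> is invariant under the congruence because \<open>f\<close> does not occur in the relations
  between 1-terms.\<close>

fun uses_f :: "(ex_ob, ex_mor) tm1 \<Rightarrow> bool" where
  "uses_f (Id1 x) = False"
| "uses_f (Gen1 g) = (g = mf)"
| "uses_f (Comp1 v u) = (uses_f v \<or> uses_f u)"

lemma eq1_uses_f: "eq1 ex_pres u v \<Longrightarrow> uses_f u = uses_f v"
  by (induction rule: eq1.induct) (auto simp: ex_pres_def)

text \<open>The normal form of a morphism from \<open>x\<close> to \<open>y\<close> in which \<open>f\<close> occurs iff \<open>h\<close>; it is meaningful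
  only if \<open>arrow x y h\<close>.\<close>

definition nf :: "ex_ob \<Rightarrow> ex_ob \<Rightarrow> bool \<Rightarrow> (ex_ob, ex_mor) tm1" where
  "nf x y h =
    (let p = if x = oL then Gen1 lambda0 else if h then Comp1 (Gen1 lambda0) (Gen1 mf) else Gen1 alpha0;
         q = if x = oL then Gen1 lambda1 else if h then Comp1 (Gen1 lambda1) (Gen1 mf) else Gen1 alpha1
     in if x = y then Id1 x else if y = oL then Gen1 mf else if x = oB then Gen1 mb
        else if x = oC then Gen1 mc else if y = oB then p else if y = oC then q
        else Comp1 (Gen1 mb) p)"

text \<open>The triples that occur for actual morphisms, as \<open>mor_ex\<close> confirms. The last
  conjunct records that X reaches L only through \<open>f\<close>.\<close>

definition arrow :: "ex_ob \<Rightarrow> ex_ob \<Rightarrow> bool \<Rightarrow> bool" where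
  "arrow x y h \<longleftrightarrow> (x = y \<or> x = oX \<or> x = oL \<and> y \<noteq> oX \<or> y = oA) \<and>
     (h \<longrightarrow> x = oX \<and> y \<noteq> oX) \<and> (x = oX \<and> y = oL \<longrightarrow> h)"

lemma nf_wf:
  assumes "arrow x y h"
  shows "wf1 ex_pres (nf x y h) \<and> tsrc ex_pres (nf x y h) = x \<and> ttrg ex_pres (nf x y h) = y \<and>
    uses_f (nf x y h) = h"
  using assms by (cases x; cases y) (simp_all add: arrow_def nf_def)

lemma arrow_comp: "arrow x y h \<Longrightarrow> arrow y z k \<Longrightarrow> arrow x z (h \<or> k)"
  by (cases x; cases y; cases z) (simp_all add: arrow_def)

text \<open>Oriented towards \<open>nf\<close>, which lets the morphisms from X and L to A pass
  through B.\<close>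

lemma eq1_square:
  "eq1 ex_pres (Comp1 (Gen1 mc) (Gen1 lambda1)) (Comp1 (Gen1 mb) (Gen1 lambda0))"
  "eq1 ex_pres (Comp1 (Gen1 mc) (Gen1 alpha1)) (Comp1 (Gen1 mb) (Gen1 alpha0))"
  by (rule eq1.sym[OF eq1.rel], simp add: ex_pres_def)+

lemma eq1_square_f:
  "eq1 ex_pres (Comp1 (Comp1 (Gen1 mb) (Gen1 lambda0)) (Gen1 mf))
     (Comp1 (Gen1 mb) (Comp1 (Gen1 lambda0) (Gen1 mf)))"
  "eq1 ex_pres (Comp1 (Gen1 mc) (Comp1 (Gen1 lambda1) (Gen1 mf)))
     (Comp1 (Gen1 mb) (Comp1 (Gen1 lambda0) (Gen1 mf)))"
proof -
  show 1: "eq1 ex_pres (Comp1 (Comp1 (Gen1 mb) (Gen1 lambda0)) (Gen1 mf))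
     (Comp1 (Gen1 mb) (Comp1 (Gen1 lambda0) (Gen1 mf)))"
    by (rule eq1.sym[OF eq1.assoc]) simp
  show "eq1 ex_pres (Comp1 (Gen1 mc) (Comp1 (Gen1 lambda1) (Gen1 mf)))
     (Comp1 (Gen1 mb) (Comp1 (Gen1 lambda0) (Gen1 mf)))"
    by (rule eq1.trans[OF eq1.assoc eq1.trans[OF eq1.cong[OF eq1.refl eq1_square(1)] 1]]) simp_all
qed

lemma nf_comp:
  assumes "arrow x y h" "arrow y z k"
  shows "eq1 ex_pres (Comp1 (nf y z k) (nf x y h)) (nf x z (h \<or> k))"
proof (cases "x = y \<or> y = z")
  case True
  then show ?thesis
  proof
    assume "x = y"
    with assms have "\<not> h" "nf x y h = Id1 x" by (auto simp: arrow_def nf_def)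
    with \<open>x = y\<close> show ?thesis
      using eq1.comp_id[of ex_pres "nf y z k"] nf_wf[OF assms(2)] by simp
  next
    assume "y = z"
    with assms have "\<not> k" "nf y z k = Id1 z" by (auto simp: arrow_def nf_def)
    with \<open>y = z\<close> show ?thesis
      using eq1.id_comp[of ex_pres "nf x y h"] nf_wf[OF assms(1)] by simp
  qed
next
  case False
  \<comment> \<open>Without identities few composable pairs remain. The composite is already normal,
    except for those into A that pass through C or have to be rebracketed around
    \<open>f\<close>.\<close>
  with assms show ?thesis
    by (cases x; cases y; cases z) (simp_all add: arrow_def nf_def eq1_square eq1_square_f eq1.refl)
qed

text \<open>Generators are normal, and by \<open>nf_comp\<close> normal forms are closed under
  composition up to congruence.\<close>

lemma eq1_nf:
  assumes "wf1 ex_pres u"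
  shows "arrow (tsrc ex_pres u) (ttrg ex_pres u) (uses_f u) \<and>
    eq1 ex_pres u (nf (tsrc ex_pres u) (ttrg ex_pres u) (uses_f u))"
  using assms
proof (induction u)
  case (Id1 x)
  then show ?case by (auto simp: arrow_def nf_def intro: eq1.refl)
next
  case (Gen1 g)
  then show ?case by (cases g) (auto simp: arrow_def nf_def intro: eq1.refl)
next
  case (Comp1 v u)
  let ?a = "tsrc ex_pres u" and ?b = "ttrg ex_pres u" and ?c = "ttrg ex_pres v"
  have a: "arrow ?a ?b (uses_f u)" "arrow ?b ?c (uses_f v)"
    and e: "eq1 ex_pres u (nf ?a ?b (uses_f u))" "eq1 ex_pres v (nf ?b ?c (uses_f v))"
    using Comp1 by auto
  have "eq1 ex_pres (Comp1 v u) (nf ?a ?c (uses_f u \<or> uses_f v))"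
    by (rule eq1.trans[OF eq1.cong[OF e Comp1.prems] nf_comp[OF a]])
  with arrow_comp[OF a] show ?case by (simp add: disj_commute)
qed

text \<open>Solves the word problem for 1-terms: the three data are invariants of the congruence,
  and terms that share them reduce to the same \<open>nf\<close>.\<close>

lemma eq1_iff:
  assumes "wf1 ex_pres u" "wf1 ex_pres v"
  shows "eq1 ex_pres u v \<longleftrightarrow> tsrc ex_pres u = tsrc ex_pres v \<and> ttrg ex_pres u = ttrg ex_pres v \<and>
    uses_f u = uses_f v"
proof
  assume "eq1 ex_pres u v"
  then show "tsrc ex_pres u = tsrc ex_pres v \<and> ttrg ex_pres u = ttrg ex_pres v \<and> uses_f u = uses_f v"
    using ex.eq1_parallel eq1_uses_f by blast
next
  assume "tsrc ex_pres u = tsrc ex_pres v \<and> ttrg ex_pres u = ttrg ex_pres v \<and> uses_f u = uses_f v"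
  with eq1_nf[OF assms(2)] have "eq1 ex_pres v (nf (tsrc ex_pres u) (ttrg ex_pres u) (uses_f u))"
    by simp
  with eq1_nf[OF assms(1)] show "eq1 ex_pres u v"
    by (blast intro: eq1.trans[OF _ eq1.sym])
qed

text \<open>The non-identity 2-morphism with target object \<open>y\<close>, meaningful only for \<open>y \<in> {oA, oB, oC}\<close>.\<close>

fun ncell :: "ex_ob \<Rightarrow> (ex_ob, ex_mor, ex_cell) tm2" where
  "ncell oB = Gen2 gamma0"
| "ncell oC = Gen2 gamma1"
| "ncell _ = HComp (Id2 (Gen1 mb)) (Gen2 gamma0)"

section \<open>Classification of the 2-morphisms\<close>

lemma gamma_square:
  "eq2 ex_pres (HComp (Id2 (Gen1 mc)) (Gen2 gamma1)) (HComp (Id2 (Gen1 mb)) (Gen2 gamma0))"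
  by (rule eq2.sym[OF eq2.rel]) (simp add: ex_pres_def)

text \<open>A non-identity 2-morphism starts at X, ends at A, B or C and removes \<open>f\<close>.
  Hence two of them compose neither vertically nor horizontally, and composing one with identities
  yields an identity-like whiskering that is again some \<open>ncell\<close>.\<close>

lemma wf2_cases:
  assumes "wf2 ex_pres s"
  shows "(uses_f (tdom ex_pres s) = uses_f (tcod ex_pres s) \<and> eq2 ex_pres s (Id2 (tdom ex_pres s))) \<or>
    (uses_f (tdom ex_pres s) \<and> \<not> uses_f (tcod ex_pres s) \<and> tsrc ex_pres (tdom ex_pres s) = oX \<and>
     ttrg ex_pres (tdom ex_pres s) \<in> {oA, oB, oC} \<and> eq2 ex_pres s (ncell (ttrg ex_pres (tdom ex_pres s))))"
    (is "?triv s \<or> ?gam s")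
  using assms
proof (induction s)
  case (Id2 u)
  then show ?case by (auto intro: eq2.refl)
next
  case (Gen2 h)
  then show ?case by (cases h) (auto intro: eq2.refl)
next
  case (VComp t s)
  then have wf: "wf2 ex_pres t" "wf2 ex_pres s" and e: "eq1 ex_pres (tdom ex_pres t) (tcod ex_pres s)"
    by auto
  note b = ex.wf2_boundary[OF wf(1)] ex.wf2_boundary[OF wf(2)] ex.eq1_parallel[OF e] eq1_uses_f[OF e]
  have ih: "?triv t \<or> ?gam t" "?triv s \<or> ?gam s"
    using VComp by auto
  from ih(2) show ?case
  proof
    \<comment> \<open>Here the composite equals \<open>t\<close> and inherits its
      alternative.\<close>
    assume s: "?triv s"
    have d: "eq1 ex_pres (tdom ex_pres t) (tdom ex_pres s)"
      using b s by (simp add: eq1_iff)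
    have "eq2 ex_pres s (Id2 (tdom ex_pres t))"
      using s by (blast intro: eq2.trans[OF _ eq2.id2_cong[OF eq1.sym[OF d]]])
    then have "eq2 ex_pres (VComp t s) (VComp t (Id2 (tdom ex_pres t)))"
      using eq2.vcong[OF _ eq2.refl[OF wf(1)] VComp.prems] by blast
    then have "eq2 ex_pres (VComp t s) t"
      using wf(1) by (rule eq2.trans[OF _ eq2.vcomp_id])
    note vt = eq2.trans[OF this]
    from ih(1) show ?case
    proof
      assume "?triv t"
      then have "eq2 ex_pres (VComp t s) (Id2 (tdom ex_pres s))"
        by (blast intro: vt eq2.trans[OF _ eq2.id2_cong[OF d]])
      with s \<open>?triv t\<close> b show ?thesis by simp
    next
      assume "?gam t"
      with vt s b show ?thesis by simp
    qed
  next
    assume s: "?gam s"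
    \<comment> \<open>After \<open>s\<close> no \<open>f\<close> is left for \<open>t\<close> to
      remove.\<close>
    with ih(1) b have t: "?triv t" by auto
    then have "eq2 ex_pres t (Id2 (tcod ex_pres s))"
      by (blast intro: eq2.trans[OF _ eq2.id2_cong[OF e]])
    then have "eq2 ex_pres (VComp t s) (VComp (Id2 (tcod ex_pres s)) s)"
      using eq2.vcong[OF eq2.refl[OF wf(2)] _ VComp.prems] by blast
    then have "eq2 ex_pres (VComp t s) s"
      using wf(2) by (rule eq2.trans[OF _ eq2.id_vcomp])
    from eq2.trans[OF this] s t b show ?case by simp
  qed
next
  case (HComp t s)
  then have wf: "wf2 ex_pres t" "wf2 ex_pres s"
    and c: "tsrc ex_pres (tdom ex_pres t) = ttrg ex_pres (tdom ex_pres s)"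
    by auto
  note b = ex.wf2_boundary[OF wf(1)] ex.wf2_boundary[OF wf(2)]
  have ih: "?triv t \<or> ?gam t" "?triv s \<or> ?gam s"
    using HComp by auto
  consider "?triv t" "?triv s" | "?triv t" "?gam s" | "?gam t" "?triv s" | "?gam t" "?gam s"
    using ih by blast
  then show ?case
  proof cases
    case 1
    then have "eq2 ex_pres (HComp t s) (HComp (Id2 (tdom ex_pres t)) (Id2 (tdom ex_pres s)))"
      using HComp.prems by (auto intro: eq2.hcong)
    also have "eq2 ex_pres \<dots> (Id2 (Comp1 (tdom ex_pres t) (tdom ex_pres s)))"
      using b c by (auto intro: eq2.hcomp_id2)
    finally (eq2.trans) show ?thesis
      using 1 by auto
  next
    case 2
    let ?y = "ttrg ex_pres (tdom ex_pres s)" and ?z = "ttrg ex_pres (tdom ex_pres t)"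
    have t: "eq1 ex_pres (tdom ex_pres t) (nf ?y ?z (uses_f (tdom ex_pres t)))"
      and a: "arrow ?y ?z (uses_f (tdom ex_pres t))"
      using eq1_nf[of "tdom ex_pres t"] b c by auto
    \<comment> \<open>A morphism that contains \<open>f\<close> starts at X, but this one starts at
      A, B or C.\<close>
    have f: "\<not> uses_f (tdom ex_pres t)"
      using a 2 by (auto simp: arrow_def)
    have "eq2 ex_pres (HComp t s) (HComp (Id2 (nf ?y ?z False)) (ncell ?y))"
    proof (rule eq2.hcong[OF _ _ HComp.prems])
      show "eq2 ex_pres s (ncell ?y)" using 2 by simp
      show "eq2 ex_pres t (Id2 (nf ?y ?z False))"
        using 2 eq2.id2_cong[OF t] f by (auto intro: eq2.trans[of _ t])
    qed
    moreover have "eq2 ex_pres (HComp (Id2 (nf ?y ?z False)) (ncell ?y)) (ncell ?z)"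
    proof (cases "?y = ?z")
      case True
      then have "nf ?y ?z False = Id1 ?y" by (simp add: nf_def)
      then show ?thesis
        using True 2 eq2.id_hcomp[of ex_pres "ncell ?y"] by auto
    next
      \<comment> \<open>Only b and c into A are left. Whiskering \<open>\<gamma>\<^sub>0\<close> by
        b is \<open>ncell oA\<close> literally; whiskering \<open>\<gamma>\<^sub>1\<close> by c
        agrees with it by the imposed 2-relation.\<close>
      case False
      then show ?thesis
        using a f 2 gamma_square
        by (auto simp: arrow_def nf_def intro!: eq2.refl)
    qed
    ultimately have "eq2 ex_pres (HComp t s) (ncell ?z)"
      by (rule eq2.trans)
    moreover have "?z \<in> {oA, oB, oC}"
      using a 2 by (auto simp: arrow_def)
    ultimately show ?thesis
      using 2 f by auto
  next
    case 3
    let ?x = "tsrc ex_pres (tdom ex_pres s)"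
    have s: "eq1 ex_pres (tdom ex_pres s) (nf ?x oX (uses_f (tdom ex_pres s)))"
      and a: "arrow ?x oX (uses_f (tdom ex_pres s))"
      using eq1_nf[of "tdom ex_pres s"] b c 3 by auto
    \<comment> \<open>The identity is the only morphism into X, so whiskering \<open>t\<close> on
      this side changes nothing.\<close>
    have x: "?x = oX" and f: "\<not> uses_f (tdom ex_pres s)"
      using a by (auto simp: arrow_def)
    have "eq2 ex_pres (HComp t s) (HComp t (Id2 (Id1 oX)))"
    proof (rule eq2.hcong[OF _ eq2.refl[OF wf(1)] HComp.prems])
      show "eq2 ex_pres s (Id2 (Id1 oX))"
        using 3 eq2.id2_cong[OF s] x f by (auto simp: nf_def intro: eq2.trans[of _ s])
    qed
    also have "eq2 ex_pres \<dots> t"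
      using eq2.hcomp_id[OF wf(1)] 3 by simp
    finally (eq2.trans) have "eq2 ex_pres (HComp t s) t" .
    from eq2.trans[OF this] 3 f x show ?thesis by simp
  next
    case 4
    \<comment> \<open>Impossible: \<open>t\<close> would start at X while \<open>s\<close> ends at
      A, B or C.\<close>
    with c show ?thesis by auto
  qed
qed

text \<open>The occurrence of \<open>f\<close> in the two boundaries decides between the
  alternatives of \<open>wf2_cases\<close>. So both terms are identities of congruent morphisms, or
  both equal the \<open>ncell\<close> of their common target.\<close>

lemma eq2_thin:
  assumes "wf2 ex_pres s" "wf2 ex_pres t"
    and "eq1 ex_pres (tdom ex_pres s) (tdom ex_pres t)" "eq1 ex_pres (tcod ex_pres s) (tcod ex_pres t)"
  shows "eq2 ex_pres s t"
proof -
  from wf2_cases[OF assms(1)] wf2_cases[OF assms(2)] ex.eq1_parallel[OF assms(3)]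
    eq1_uses_f[OF assms(3)] eq1_uses_f[OF assms(4)]
  consider "eq2 ex_pres s (Id2 (tdom ex_pres s))" "eq2 ex_pres t (Id2 (tdom ex_pres t))"
    | r where "eq2 ex_pres s r" "eq2 ex_pres t r"
    by auto
  then show ?thesis
  proof cases
    case 1
    then show ?thesis
      by (blast intro: eq2.trans[OF eq2.trans[OF _ eq2.id2_cong[OF assms(3)]] eq2.sym])
  next
    case 2
    then show ?thesis by (blast intro: eq2.trans[OF _ eq2.sym])
  qed
qed


section \<open>The hom-categories of the example\<close>

definition em :: "ex_ob \<Rightarrow> ex_ob \<Rightarrow> bool \<Rightarrow> (ex_ob, ex_mor) tm1 set" where
  "em x y h = cls1 ex_pres (nf x y h)"

lemma mor_ex: "mor ex_two_cat M x y \<longleftrightarrow> (\<exists>h. arrow x y h \<and> M = em x y h)"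
proof
  assume "mor ex_two_cat M x y"
  then obtain u where u: "wf1 ex_pres u" "M = cls1 ex_pres u" "tsrc ex_pres u = x" "ttrg ex_pres u = y"
    by (auto simp: ex_two_cat_def ex.mor_presented)
  with eq1_nf[OF u(1)] show "\<exists>h. arrow x y h \<and> M = em x y h"
    by (auto simp: em_def ex.cls1_eq)
next
  assume "\<exists>h. arrow x y h \<and> M = em x y h"
  then show "mor ex_two_cat M x y"
    unfolding ex_two_cat_def ex.mor_presented em_def using nf_wf by blast
qed

lemma mor_em: "arrow x y h \<Longrightarrow> mor ex_two_cat (em x y h) x y"
  using mor_ex by blast

lemma em_Mo: "arrow x y h \<Longrightarrow> em x y h \<in> Mo ex_two_cat"
  and em_src: "arrow x y h \<Longrightarrow> src ex_two_cat (em x y h) = x"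
  and em_trg: "arrow x y h \<Longrightarrow> trg ex_two_cat (em x y h) = y"
  using mor_em[of x y h] by (auto simp: mor_def)

lemma em_eq_iff: "arrow x y h \<Longrightarrow> arrow x y k \<Longrightarrow> em x y h = em x y k \<longleftrightarrow> h = k"
  using nf_wf[of x y h] nf_wf[of x y k] eq1_uses_f[of "nf x y h" "nf x y k"]
  by (cases "h = k") (auto simp: em_def ex.cls1_eq)

lemma em_comp:
  assumes "arrow x y h" "arrow y z k"
  shows "comp1 ex_two_cat (em y z k) (em x y h) = em x z (h \<or> k)"
  using nf_wf[OF assms(1)] nf_wf[OF assms(2)] nf_comp[OF assms]
  by (simp add: ex_two_cat_def em_def ex.comp1_cls1 ex.cls1_eq)

lemma id1_ex: "id1 ex_two_cat x = em x x False"
  by (simp add: ex_two_cat_def ex.id1_presented em_def nf_def)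

lemma arrow_id: "arrow x x False"
  by (simp add: arrow_def)

lemma Ob_ex: "Ob ex_two_cat = UNIV"
  by (simp add: ex_two_cat_def ex.Ob_presented)

text \<open>Reduces every later equation between 2-morphisms to a check of boundaries.\<close>

lemma cell_thin:
  assumes "cell ex_two_cat S M N" "cell ex_two_cat T M N"
  shows "S = T"
proof -
  from assms obtain s t where "wf2 ex_pres s" "S = cls2 ex_pres s" "M = cls1 ex_pres (tdom ex_pres s)"
    "N = cls1 ex_pres (tcod ex_pres s)" "wf2 ex_pres t" "T = cls2 ex_pres t"
    "M = cls1 ex_pres (tdom ex_pres t)" "N = cls1 ex_pres (tcod ex_pres t)"
    by (auto simp: ex_two_cat_def ex.cell_presented)
  then show ?thesis
    using eq2_thin[of s t] ex.wf2_boundary by (metis ex.cls1_eq ex.cls2_eq)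
qed

text \<open>A 2-morphism may remove \<open>f\<close> but never introduces it.\<close>

lemma cell_em:
  assumes "cell ex_two_cat S (em x y h) (em x y k)" "arrow x y h" "arrow x y k"
  shows "k \<longrightarrow> h"
proof -
  from assms(1) obtain s where s: "wf2 ex_pres s" "cls1 ex_pres (nf x y h) = cls1 ex_pres (tdom ex_pres s)"
    "cls1 ex_pres (nf x y k) = cls1 ex_pres (tcod ex_pres s)"
    by (auto simp: ex_two_cat_def ex.cell_presented em_def)
  with nf_wf[OF assms(2)] nf_wf[OF assms(3)]
  have "eq1 ex_pres (nf x y h) (tdom ex_pres s)" "eq1 ex_pres (nf x y k) (tcod ex_pres s)"
    by (simp_all add: ex.cls1_eq)
  with nf_wf[OF assms(2)] nf_wf[OF assms(3)] wf2_cases[OF s(1)] show ?thesis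
    by (auto dest: eq1_uses_f)
qed

lemma ex_cell_em:
  assumes "arrow x y h" "arrow x y k" "k \<longrightarrow> h"
  shows "\<exists>S. cell ex_two_cat S (em x y h) (em x y k)"
proof (cases "h = k")
  case True
  then show ?thesis using E.id2_cell[OF em_Mo[OF assms(1)]] by blast
next
  case False
  with assms have "h" "\<not> k" by simp_all
  \<comment> \<open>Both values occur only from X, and not towards L, where \<open>f\<close> is
    forced. The targets left are those of the three genuine values of \<open>ncell\<close>.\<close>
  with assms have "x = oX" "y \<noteq> oX" "y \<noteq> oL" by (simp_all add: arrow_def)
  with \<open>h\<close> \<open>\<not> k\<close> have "wf2 ex_pres (ncell y)" "nf x y h = tdom ex_pres (ncell y)"
    "nf x y k = tcod ex_pres (ncell y)"
    by (cases y; simp add: nf_def)+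
  then have "cell ex_two_cat (cls2 ex_pres (ncell y)) (em x y h) (em x y k)"
    unfolding ex_two_cat_def ex.cell_presented em_def by (intro exI[of _ "ncell y"]) simp
  then show ?thesis ..
qed

text \<open>An inverse runs in the opposite direction, so \<open>cell_em\<close> applied both ways
  makes the boundaries equal; thinness then identifies the 2-morphism with the identity.\<close>

lemma invertible2_ex:
  assumes "invertible2 ex_two_cat S"
  shows "cod2 ex_two_cat S = dom2 ex_two_cat S \<and> S = id2 ex_two_cat (dom2 ex_two_cat S)"
proof -
  obtain M N where MN: "dom2 ex_two_cat S = M" "cod2 ex_two_cat S = N" by blast
  from assms have S: "cell ex_two_cat S M N"
    using E.cell[of S] MN by (simp add: invertible2_def)
  from assms obtain T where T: "cell ex_two_cat T N M"
    using MN by (auto simp: invertible2_def)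
  from S obtain x y where "mor ex_two_cat M x y" "mor ex_two_cat N x y"
    unfolding cell_def by blast
  then obtain h k where h: "arrow x y h" "M = em x y h" and k: "arrow x y k" "N = em x y k"
    unfolding mor_ex by blast
  have "k \<longrightarrow> h" "h \<longrightarrow> k"
    using cell_em[OF S[unfolded h(2) k(2)] h(1) k(1)] cell_em[OF T[unfolded h(2) k(2)] k(1) h(1)]
    by blast+
  then have "N = M" using h(2) k(2) by (cases h; cases k; simp)
  moreover have "S = id2 ex_two_cat M"
    using cell_thin[OF S] E.id2_cell[OF em_Mo[OF h(1)]] \<open>N = M\<close> h(2) by blast
  ultimately show ?thesis using MN by simp
qed


section \<open>Pseudo-cones and modifications\<close>

lemma cospan_simps [simp]:
  "Ob cospan = UNIV" "Mo cospan = UNIV" "Ce cospan = UNIV" "src cospan = cospan_dom"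
  "trg cospan = cospan_cod" "dom2 cospan u = u" "cod2 cospan u = u" "id1 cospan = Ident"
  "id2 cospan u = u" "vcomp cospan v u = u" "hcomp cospan = comp1 cospan"
  "comp1 cospan v u = (case u of Ident _ \<Rightarrow> v | _ \<Rightarrow> u)"
  by (simp_all add: cospan_def locally_discrete_def cospan_cat_def)

lemma mor_cospan: "mor cospan u i j \<longleftrightarrow> cospan_dom u = i \<and> cospan_cod u = j"
  by (simp add: mor_def)

lemma cell_cospan: "cell cospan s u v \<longleftrightarrow> s = u \<and> s = v"
  by (auto simp: cell_def mor_cospan)

text \<open>Reduces functoriality of the diagram on composites to the unit laws.\<close>

lemma cospan_cod_Ident: "cospan_cod u = cospan_dom v \<Longrightarrow> (\<exists>i. u = Ident i) \<or> (\<exists>i. v = Ident i)"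
  by (cases u; cases v) auto

text \<open>The composite after a non-identity \<open>u\<close> is \<open>u\<close> itself; this has
  the right target because whatever follows \<open>u\<close> starts, hence ends, at
  \<open>Mid\<close>.\<close>

lemma cospan_dom_Mid: "cospan_dom u = Mid \<Longrightarrow> cospan_cod u = Mid"
  by (cases u) auto

interpretation cospan: two_category cospan
  by standard (auto simp: mor_cospan cell_cospan cospan_dom_Mid split: cospan_mor.splits)

lemma two_functor_Delta_ob:
  assumes "two_category I" "two_category A" "X \<in> Ob A"
  shows "two_functor I A (Delta_ob I A X)"
proof -
  interpret I: two_category I by fact
  interpret A: two_category A by fact
  have i: "mor A (id1 A X) X X" "id1 A X \<in> Mo A"
    using A.id1_mor[OF assms(3)] by (simp_all add: mor_def)
  show ?thesis
  proof
    show "fob (Delta_ob I A X) \<in> extensional (Ob I)" "fmo (Delta_ob I A X) \<in> extensional (Mo I)"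
      "fce (Delta_ob I A X) \<in> extensional (Ce I)"
      by (simp_all add: Delta_ob_def)
    show "fob (Delta_ob I A X) i \<in> Ob A" if "i \<in> Ob I" for i
      using that assms(3) by (simp add: Delta_ob_def)
    show "mor A (fmo (Delta_ob I A X) u) (fob (Delta_ob I A X) i) (fob (Delta_ob I A X) j)"
      if "mor I u i j" for u i j
      using that i(1) by (simp add: Delta_ob_def mor_def)
    show "cell A (fce (Delta_ob I A X) s) (fmo (Delta_ob I A X) u) (fmo (Delta_ob I A X) v)"
      if "cell I s u v" for s u v
      using that A.id2_cell[OF i(2)] by (auto simp: Delta_ob_def cell_def mor_def)
    show "fmo (Delta_ob I A X) (id1 I i) = id1 A (fob (Delta_ob I A X) i)" if "i \<in> Ob I" for i
      using that I.id1_mor[OF that] by (simp add: Delta_ob_def mor_def)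
    show "fmo (Delta_ob I A X) (comp1 I v u) =
        comp1 A (fmo (Delta_ob I A X) v) (fmo (Delta_ob I A X) u)"
      if "mor I u i j" "mor I v j k" for u v i j k
      using that I.comp1_mor[OF that] A.comp1_id1[OF i(1)] by (simp add: Delta_ob_def mor_def)
    show "fce (Delta_ob I A X) (id2 I u) = id2 A (fmo (Delta_ob I A X) u)" if "u \<in> Mo I" for u
      using that I.id2_cell[OF that] by (simp add: Delta_ob_def cell_def)
    show "fce (Delta_ob I A X) (vcomp I t s) =
        vcomp A (fce (Delta_ob I A X) t) (fce (Delta_ob I A X) s)"
      if "cell I s u v" "cell I t v w" for s t u v w
      using that I.vcomp_cell[OF that] A.vcomp_id2[OF A.id2_cell[OF i(2)]]
      by (simp add: Delta_ob_def cell_def)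
    show "fce (Delta_ob I A X) (hcomp I t s) =
        hcomp A (fce (Delta_ob I A X) t) (fce (Delta_ob I A X) s)"
      if "cell I s u u'" "cell I t v v'" "src I v = trg I u" for s t u u' v v'
      using that I.hcomp_cell[OF that] A.hcomp_id2[OF i(1) i(1)] A.comp1_id1[OF i(1)]
      by (simp add: Delta_ob_def cell_def)
  qed
qed

lemma ex_fmo_em: "ex_fmo u = em (ex_fob (cospan_dom u)) (ex_fob (cospan_cod u)) False"
  by (cases u) (simp_all add: id1_ex, simp_all add: em_def nf_def)

lemma arrow_ex_fob: "arrow (ex_fob (cospan_dom u)) (ex_fob (cospan_cod u)) False"
  by (cases u) (simp_all add: arrow_def)

lemma two_functor_ex_diagram: "two_functor cospan ex_two_cat ex_diagram"
proof
  have m: "mor ex_two_cat (ex_fmo u) (ex_fob (cospan_dom u)) (ex_fob (cospan_cod u))" for u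
    unfolding ex_fmo_em by (rule mor_em[OF arrow_ex_fob])
  then have M: "ex_fmo u \<in> Mo ex_two_cat" for u
    by (simp add: mor_def)
  have c: "ex_fmo (comp1 cospan v u) = comp1 ex_two_cat (ex_fmo v) (ex_fmo u)"
    if "cospan_cod u = cospan_dom v" for u v
    using cospan_cod_Ident[OF that] that E.comp1_id1[OF m[of v]] E.id1_comp1[OF m[of u]]
    by (cases u) (auto simp del: ex_fmo.simps simp: ex_fmo.simps(1))
  show "fob ex_diagram \<in> extensional (Ob cospan)" "fmo ex_diagram \<in> extensional (Mo cospan)"
    "fce ex_diagram \<in> extensional (Ce cospan)"
    by (simp_all add: extensional_def)
  show "fob ex_diagram i \<in> Ob ex_two_cat" for i
    by (simp add: Ob_ex)
  show "mor ex_two_cat (fmo ex_diagram u) (fob ex_diagram i) (fob ex_diagram j)"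
    if "mor cospan u i j" for u i j
    using that m[of u] by (simp add: mor_cospan ex_diagram_def)
  show "cell ex_two_cat (fce ex_diagram s) (fmo ex_diagram u) (fmo ex_diagram v)"
    if "cell cospan s u v" for s u v
    using that E.id2_cell[OF M[of u]] by (auto simp: cell_cospan ex_diagram_def)
  show "fmo ex_diagram (id1 cospan i) = id1 ex_two_cat (fob ex_diagram i)" for i
    by (simp add: ex_diagram_def)
  show "fmo ex_diagram (comp1 cospan v u) = comp1 ex_two_cat (fmo ex_diagram v) (fmo ex_diagram u)"
    if "mor cospan u i j" "mor cospan v j k" for u v i j k
    using that c[of u v] by (simp add: mor_cospan ex_diagram_def)
  show "fce ex_diagram (id2 cospan u) = id2 ex_two_cat (fmo ex_diagram u)" for u
    by (simp add: ex_diagram_def)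
  show "fce ex_diagram (vcomp cospan t s) =
      vcomp ex_two_cat (fce ex_diagram t) (fce ex_diagram s)"
    if "cell cospan s u v" "cell cospan t v w" for s t u v w
    using that E.vcomp_id2[OF E.id2_cell[OF M[of u]]] by (auto simp: cell_cospan ex_diagram_def)
  show "fce ex_diagram (hcomp cospan t s) =
      hcomp ex_two_cat (fce ex_diagram t) (fce ex_diagram s)"
    if "cell cospan s u u'" "cell cospan t v v'" "src cospan v = trg cospan u" for s t u u' v v'
    using that c[of u v] E.hcomp_id2[OF m[of u], of "ex_fmo v" "ex_fob (cospan_cod v)"] m[of v]
    by (simp add: cell_cospan ex_diagram_def)
qed


section \<open>Pseudo-cones over the diagram\<close>

type_synonym ex_ptrans = "(cospan_ob, cospan_mor, cospan_mor, ex_ob, (ex_ob, ex_mor) tm1 set,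
  (ex_ob, ex_mor, ex_cell) tm2 set) ptrans"

text \<open>\<open>cone oL False\<close>, \<open>cone oX True\<close> and \<open>cone oX False\<close> are \<open>\<lambda>\<close>, \<open>\<lambda> \<Delta>f\<close> and \<open>\<alpha>\<close>.\<close>

definition cone :: "ex_ob \<Rightarrow> bool \<Rightarrow> ex_ptrans" where
  "cone x h = \<lparr> psrc = Delta_ob cospan ex_two_cat x, ptrg = ex_diagram,
     pob = (\<lambda>i. em x (ex_fob i) h),
     pmo = (\<lambda>u. id2 ex_two_cat (em x (ex_fob (cospan_cod u)) h)) \<rparr>"

text \<open>The parameters for which \<open>cone x h\<close> is a pseudo-cone: none of A, B, C has
  morphisms to both B and C, and no morphism from L contains \<open>f\<close>.\<close>

definition apex :: "ex_ob \<Rightarrow> bool \<Rightarrow> bool" where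
  "apex x h \<longleftrightarrow> x = oX \<or> x = oL \<and> \<not> h"

lemma apex_arrow: "apex x h \<Longrightarrow> arrow x (ex_fob i) h"
  by (cases i) (auto simp: apex_def arrow_def)

lemma arrow_apex: "arrow x oB h \<Longrightarrow> arrow x oC h \<Longrightarrow> apex x h"
  by (cases x) (auto simp: apex_def arrow_def)

lemma ex_cone_eq: "ex_cone = cone oL False"
proof -
  have "arrow oL oB False" "arrow oB oA False" by (simp_all add: arrow_def)
  from em_comp[OF this] have "comp1 ex_two_cat (gen mb) (gen lambda0) = em oL oA False"
    by (simp add: em_def nf_def)
  then have "ex_leg i = em oL (ex_fob i) False" for i
    by (cases i) (simp_all, simp_all add: em_def nf_def)
  then show ?thesis
    by (simp add: ex_cone_def cone_def fun_eq_iff)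
qed

lemma Delta_ob_cospan:
  "fob (Delta_ob cospan A x) i = x" "fmo (Delta_ob cospan A x) u = id1 A x"
  "fce (Delta_ob cospan A x) s = id2 A (id1 A x)"
  by (simp_all add: Delta_ob_def)

text \<open>The diagram does not involve \<open>f\<close>, so its morphisms carry legs with a common
  \<open>h\<close> to one another strictly.\<close>

lemma ex_fmo_leg:
  assumes "arrow x (ex_fob (cospan_dom u)) h"
  shows "comp1 ex_two_cat (ex_fmo u) (em x (ex_fob (cospan_dom u)) h) = em x (ex_fob (cospan_cod u)) h"
  using em_comp[OF assms arrow_ex_fob] by (simp add: ex_fmo_em)

lemma em_id1: "arrow x y h \<Longrightarrow> comp1 ex_two_cat (em x y h) (id1 ex_two_cat x) = em x y h"
  using E.comp1_id1[OF mor_em] .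

lemma hcomp_id2_em:
  "arrow x y h \<Longrightarrow> arrow y z k \<Longrightarrow>
    hcomp ex_two_cat (id2 ex_two_cat (em y z k)) (id2 ex_two_cat (em x y h)) =
    id2 ex_two_cat (em x z (h \<or> k))"
  using E.hcomp_id2[OF mor_em mor_em] em_comp by metis

lemma vcomp_id2_em:
  "arrow x y h \<Longrightarrow> vcomp ex_two_cat (id2 ex_two_cat (em x y h)) (id2 ex_two_cat (em x y h)) =
    id2 ex_two_cat (em x y h)"
  using E.vcomp_id2[OF E.id2_cell[OF em_Mo]] .

lemma two_functor_Delta_ex: "two_functor cospan ex_two_cat (Delta_ob cospan ex_two_cat x)"
  by (rule two_functor_Delta_ob) (simp_all add: cospan.two_category_axioms E.two_category_axioms Ob_ex)

lemma invertible2_id2: "f \<in> Mo ex_two_cat \<Longrightarrow> invertible2 ex_two_cat (id2 ex_two_cat f)"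
  using E.id2_cell[of f] E.vcomp_id2[OF E.id2_cell[of f]]
  by (auto simp: invertible2_def cell_def)

text \<open>The legs commute strictly, so in every axiom both sides collapse to the identity of a
  leg.\<close>

lemma pseudonatural_cone:
  assumes "apex x h"
  shows "pseudonatural cospan ex_two_cat (cone x h)"
proof -
  note a = apex_arrow[OF assms]
  interpret D: two_functor cospan ex_two_cat "Delta_ob cospan ex_two_cat x"
    by (rule two_functor_Delta_ex)
  interpret F: two_functor cospan ex_two_cat ex_diagram
    by (rule two_functor_ex_diagram)
  have s: "psrc (cone x h) = Delta_ob cospan ex_two_cat x" "ptrg (cone x h) = ex_diagram"
    by (simp_all add: cone_def)
  show ?thesis
  proof (intro pseudonatural.intro pseudonatural_axioms.intro; (unfold s)?)
    show "two_functor cospan ex_two_cat (Delta_ob cospan ex_two_cat x)"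
      "two_functor cospan ex_two_cat ex_diagram"
      by unfold_locales
    show "pob (cone x h) \<in> extensional (Ob cospan)" "pmo (cone x h) \<in> extensional (Mo cospan)"
      by (simp_all add: extensional_def)
    show "mor ex_two_cat (pob (cone x h) i) (fob (Delta_ob cospan ex_two_cat x) i) (fob ex_diagram i)"
      for i
      using mor_em[OF a[of i]] by (simp add: Delta_ob_cospan cone_def ex_diagram_def)
    show "cell ex_two_cat (pmo (cone x h) u)
        (comp1 ex_two_cat (fmo ex_diagram u) (pob (cone x h) i))
        (comp1 ex_two_cat (pob (cone x h) j) (fmo (Delta_ob cospan ex_two_cat x) u))"
      if "mor cospan u i j" for u i j
      using that ex_fmo_leg[OF a, of u] em_id1[OF a[of j]] E.id2_cell[OF em_Mo[OF a[of j]]]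
      by (simp add: mor_cospan Delta_ob_cospan cone_def ex_diagram_def)
    show "invertible2 ex_two_cat (pmo (cone x h) u)" for u
      using invertible2_id2[OF em_Mo[OF a]] by (simp add: cone_def)
    show "pmo (cone x h) (id1 cospan i) = id2 ex_two_cat (pob (cone x h) i)" for i
      by (simp add: cone_def)
    show "pmo (cone x h) (comp1 cospan v u) =
        vcomp ex_two_cat (rwhisk ex_two_cat (pmo (cone x h) v) (fmo (Delta_ob cospan ex_two_cat x) u))
          (lwhisk ex_two_cat (fmo ex_diagram v) (pmo (cone x h) u))"
      if "mor cospan u i j" "mor cospan v j k" for u v i j k
    proof -
      have "hcomp ex_two_cat (id2 ex_two_cat (em x (ex_fob k) h)) (id2 ex_two_cat (id1 ex_two_cat x)) =
          id2 ex_two_cat (em x (ex_fob k) h)"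
        using hcomp_id2_em[OF arrow_id a[of k]] by (simp add: id1_ex)
      moreover have "hcomp ex_two_cat (id2 ex_two_cat (ex_fmo v)) (id2 ex_two_cat (em x (ex_fob j) h)) =
          id2 ex_two_cat (em x (ex_fob k) h)"
        using hcomp_id2_em[OF a[of j], of "ex_fob k" False] arrow_ex_fob[of v] that
        by (simp add: mor_cospan ex_fmo_em)
      moreover have "cospan_cod (comp1 cospan v u) = k"
        using cospan.comp1_mor[OF that] by (simp only: mor_cospan)
      ultimately show ?thesis
        using that vcomp_id2_em[OF a[of k]]
        by (simp add: mor_cospan Delta_ob_cospan cone_def ex_diagram_def rwhisk_def lwhisk_def
            del: cospan_simps)
    qed
    show "vcomp ex_two_cat (pmo (cone x h) v) (rwhisk ex_two_cat (fce ex_diagram s) (pob (cone x h) i)) =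
        vcomp ex_two_cat (lwhisk ex_two_cat (pob (cone x h) j) (fce (Delta_ob cospan ex_two_cat x) s))
          (pmo (cone x h) u)"
      if "mor cospan u i j" "mor cospan v i j" "cell cospan s u v" for u v s i j
    proof -
      have "hcomp ex_two_cat (id2 ex_two_cat (em x (ex_fob j) h)) (id2 ex_two_cat (id1 ex_two_cat x)) =
          id2 ex_two_cat (em x (ex_fob j) h)"
        using hcomp_id2_em[OF arrow_id a[of j]] by (simp add: id1_ex)
      moreover have "hcomp ex_two_cat (id2 ex_two_cat (ex_fmo u)) (id2 ex_two_cat (em x (ex_fob i) h)) =
          id2 ex_two_cat (em x (ex_fob j) h)"
        using hcomp_id2_em[OF a[of i], of "ex_fob j" False] arrow_ex_fob[of u] that
        by (simp add: mor_cospan ex_fmo_em)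
      ultimately show ?thesis
        using that
        by (simp add: mor_cospan cell_cospan Delta_ob_cospan cone_def ex_diagram_def rwhisk_def
            lwhisk_def)
    qed
  qed
qed

text \<open>The structure 2-morphisms are invertible, hence identities, so the cone is strict.
  Comparing its legs in A then forces all of them to agree on the occurrence of
  \<open>f\<close>.\<close>

lemma pseudonatural_eq_cone:
  assumes "pseudonatural cospan ex_two_cat \<mu>" "psrc \<mu> = Delta_ob cospan ex_two_cat x"
    "ptrg \<mu> = ex_diagram"
  shows "\<exists>h. apex x h \<and> \<mu> = cone x h"
proof -
  interpret pseudonatural cospan ex_two_cat \<mu> by fact
  have "mor ex_two_cat (pob \<mu> i) x (ex_fob i)" for i
    using pob[of i] assms by (simp add: Delta_ob_cospan ex_diagram_def)
  then have "\<exists>h. arrow x (ex_fob i) h \<and> pob \<mu> i = em x (ex_fob i) h" for i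
    by (simp add: mor_ex)
  then obtain H where H: "\<And>i. arrow x (ex_fob i) (H i)" "\<And>i. pob \<mu> i = em x (ex_fob i) (H i)"
    by metis
  have c: "cell ex_two_cat (pmo \<mu> u) (em x (ex_fob (cospan_cod u)) (H (cospan_dom u)))
      (em x (ex_fob (cospan_cod u)) (H (cospan_cod u)))" for u
    using pmo[of u "cospan_dom u" "cospan_cod u"] ex_fmo_leg[OF H(1), of u]
      em_id1[OF H(1)] assms
    by (simp add: mor_cospan Delta_ob_cospan ex_diagram_def H(2))
  have inv: "pmo \<mu> u = id2 ex_two_cat (em x (ex_fob (cospan_cod u)) (H (cospan_cod u)))"
    "em x (ex_fob (cospan_cod u)) (H (cospan_dom u)) = em x (ex_fob (cospan_cod u)) (H (cospan_cod u))"
    for u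
    using invertible2_ex[OF pmo_invertible[of u]] c[of u] by (auto simp: cell_def)
  \<comment> \<open>Makes \<open>em_eq_iff\<close> applicable in A: following a leg into A preserves
    its occurrence of \<open>f\<close>.\<close>
  have "arrow x oA (H i)" for i
    using arrow_comp[OF H(1)[of i], of oA False] by (cases i) (simp_all add: arrow_def)
  then have LR: "H Left = H Mid" "H Right = H Mid"
    using inv(2)[of LeftMid] inv(2)[of RightMid] by (simp_all add: em_eq_iff)
  define k where "k = H Mid"
  have Hk: "H i = k" for i
    using LR by (cases i) (simp_all add: k_def)
  have "apex x k"
    using H(1)[of Left] H(1)[of Right] by (simp add: arrow_apex Hk)
  moreover have "\<mu> = cone x k"
    by (rule ptrans.equality) (simp_all add: cone_def fun_eq_iff assms H(2) inv(1) Hk)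
  ultimately show ?thesis by blast
qed

lemma mor_Ps: "mor (Ps I A) \<mu> F G \<longleftrightarrow> pseudonatural I A \<mu> \<and> psrc \<mu> = F \<and> ptrg \<mu> = G"
  by (auto simp: mor_def Ps_def pseudonatural_def)

lemma pseudo_cone_iff: "pseudo_cone cospan ex_two_cat ex_diagram x \<mu> \<longleftrightarrow> (\<exists>h. apex x h \<and> \<mu> = cone x h)"
  unfolding pseudo_cone_def mor_Ps
  using pseudonatural_eq_cone pseudonatural_cone by (auto simp: Ob_ex cone_def)


section \<open>Modifications between the pseudo-cones\<close>

lemma cell_Ps: "cell (Ps I A) \<phi> \<mu> \<nu> \<longleftrightarrow> modification I A \<phi> \<and> msrc \<phi> = \<mu> \<and> mtrg \<phi> = \<nu>"
  unfolding cell_def mor_Ps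
  by (auto simp: Ps_def modification_def modification_axioms_def)

lemma modification_eqI:
  assumes "modification cospan ex_two_cat \<phi>" "modification cospan ex_two_cat \<psi>"
    and "msrc \<phi> = msrc \<psi>" "mtrg \<phi> = mtrg \<psi>"
  shows "\<phi> = \<psi>"
proof -
  interpret \<phi>: modification cospan ex_two_cat \<phi> by fact
  interpret \<psi>: modification cospan ex_two_cat \<psi> by fact
  have "mob \<phi> i = mob \<psi> i" for i
    using cell_thin[OF \<phi>.mob[of i]] \<psi>.mob[of i] assms by simp
  with assms show ?thesis by (simp add: fun_eq_iff)
qed

text \<open>Components exist by \<open>ex_cell_em\<close> and may be chosen separately. Thinness
  makes them compatible; for a modification to \<alpha> this is where the imposed 2-relation
  enters.\<close>

lemma ex_modification:
  assumes h: "apex x h" and k: "apex x k" and le: "k \<longrightarrow> h"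
  shows "\<exists>\<phi>. modification cospan ex_two_cat \<phi> \<and> msrc \<phi> = cone x h \<and> mtrg \<phi> = cone x k"
proof -
  have "\<exists>S. cell ex_two_cat S (em x (ex_fob i) h) (em x (ex_fob i) k)" for i
    by (rule ex_cell_em[OF apex_arrow[OF h] apex_arrow[OF k] le])
  then obtain S where S: "\<And>i. cell ex_two_cat (S i) (em x (ex_fob i) h) (em x (ex_fob i) k)"
    by metis
  define \<phi> :: "(cospan_ob, cospan_mor, cospan_mor, ex_ob, (ex_ob, ex_mor) tm1 set,
      (ex_ob, ex_mor, ex_cell) tm2 set) modif"
    where "\<phi> = \<lparr> msrc = cone x h, mtrg = cone x k, mob = S \<rparr>"
  have s: "msrc \<phi> = cone x h" "mtrg \<phi> = cone x k" "mob \<phi> = S"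
    by (simp_all add: \<phi>_def)
  interpret h: pseudonatural cospan ex_two_cat "cone x h" by (rule pseudonatural_cone[OF h])
  interpret k: pseudonatural cospan ex_two_cat "cone x k" by (rule pseudonatural_cone[OF k])
  have "modification cospan ex_two_cat \<phi>"
  proof (intro modification.intro modification_axioms.intro; (unfold s)?)
    show "pseudonatural cospan ex_two_cat (cone x h)" "pseudonatural cospan ex_two_cat (cone x k)"
      by unfold_locales
    show "psrc (cone x k) = psrc (cone x h)" "ptrg (cone x k) = ptrg (cone x h)"
      by (simp_all add: cone_def)
    show "S \<in> extensional (Ob cospan)" by (simp add: extensional_def)
    show "cell ex_two_cat (S i) (pob (cone x h) i) (pob (cone x k) i)" for i
      using S[of i] by (simp add: cone_def)
    show "vcomp ex_two_cat (pmo (cone x k) u) (lwhisk ex_two_cat (fmo (ptrg (cone x h)) u) (S i)) =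
        vcomp ex_two_cat (rwhisk ex_two_cat (S j) (fmo (psrc (cone x h)) u)) (pmo (cone x h) u)"
      if "mor cospan u i j" for u i j
    \<comment> \<open>Only the common boundary of the two sides has to be computed.\<close>
    proof (rule cell_thin)
      have m: "mor ex_two_cat (ex_fmo u) (ex_fob i) (ex_fob j)"
        using that mor_em[OF arrow_ex_fob[of u]] by (simp add: mor_cospan ex_fmo_em)
      then have "cell ex_two_cat (id2 ex_two_cat (ex_fmo u)) (ex_fmo u) (ex_fmo u)"
        by (intro E.id2_cell) (simp add: mor_def)
      from E.hcomp_cell[OF S this]
      have "cell ex_two_cat (lwhisk ex_two_cat (ex_fmo u) (S i))
          (comp1 ex_two_cat (ex_fmo u) (em x (ex_fob i) h))
          (comp1 ex_two_cat (ex_fmo u) (em x (ex_fob i) k))"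
        using m em_trg[OF apex_arrow[OF h]] by (simp add: mor_def lwhisk_def)
      from E.vcomp_cell[OF this] k.pmo[OF that]
      show "cell ex_two_cat
          (vcomp ex_two_cat (pmo (cone x k) u) (lwhisk ex_two_cat (fmo (ptrg (cone x h)) u) (S i)))
          (comp1 ex_two_cat (ex_fmo u) (em x (ex_fob i) h))
          (comp1 ex_two_cat (em x (ex_fob j) k) (id1 ex_two_cat x))"
        by (simp add: cone_def ex_diagram_def Delta_ob_cospan)
      have "cell ex_two_cat (id2 ex_two_cat (id1 ex_two_cat x)) (id1 ex_two_cat x) (id1 ex_two_cat x)"
        by (rule E.id2_cell) (simp add: id1_ex em_Mo[OF arrow_id])
      from E.hcomp_cell[OF this S]
      have "cell ex_two_cat (rwhisk ex_two_cat (S j) (id1 ex_two_cat x))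
          (comp1 ex_two_cat (em x (ex_fob j) h) (id1 ex_two_cat x))
          (comp1 ex_two_cat (em x (ex_fob j) k) (id1 ex_two_cat x))"
        using em_src[OF apex_arrow[OF h]] em_trg[OF arrow_id] by (simp add: rwhisk_def id1_ex)
      with E.vcomp_cell[OF h.pmo[OF that]]
      show "cell ex_two_cat
          (vcomp ex_two_cat (rwhisk ex_two_cat (S j) (fmo (psrc (cone x h)) u)) (pmo (cone x h) u))
          (comp1 ex_two_cat (ex_fmo u) (em x (ex_fob i) h))
          (comp1 ex_two_cat (em x (ex_fob j) k) (id1 ex_two_cat x))"
        by (simp add: cone_def ex_diagram_def Delta_ob_cospan)
    qed
  qed
  with s show ?thesis by blast
qed

text \<open>The hypothesis admits only \<open>f\<close> and the identity of L, so the strict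
  composites with \<lambda> are \<open>cone oX True\<close> and
  \<open>cone oL False\<close>.\<close>

lemma ptrans_comp_cone:
  assumes "arrow x oL k"
  shows "ptrans_comp cospan ex_two_cat (cone oL False) (Delta_mor cospan ex_two_cat (em x oL k)) =
    cone x k"
proof -
  have a: "arrow oL (ex_fob i) False" for i
    by (rule apex_arrow) (simp add: apex_def)
  then have "vcomp ex_two_cat (id2 ex_two_cat (em x (ex_fob i) k)) (id2 ex_two_cat (em x (ex_fob i) k)) =
      id2 ex_two_cat (em x (ex_fob i) k)" for i
    using vcomp_id2_em arrow_comp[OF assms a, of i] by simp
  with a show ?thesis
    using em_comp[OF assms] hcomp_id2_em[OF assms] em_src[OF assms]
    by (simp add: ptrans_comp_def cone_def Delta_mor_def lwhisk_def rwhisk_def restrict_def)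
qed

section \<open>2-terminality and failure of the pseudo-limit property\<close>

lemma isomorphic_terminal_cat:
  assumes "cobj C = {p}" "carr C = {a}" "cdom C a = p" "ccod C a = p" "cid C p = a" "ccomp C a a = a"
  shows "isomorphic_cats C terminal_cat"
proof -
  have "category C" "category terminal_cat"
    by (standard; use assms in \<open>auto simp: car_def terminal_cat_def\<close>)+
  then have "cat_functor C terminal_cat (\<lambda>_. ()) (\<lambda>_. ())"
    "cat_functor terminal_cat C (\<lambda>_. p) (\<lambda>_. a)"
    using assms
    by (auto simp: cat_functor_def cat_functor_axioms_def car_def terminal_cat_def)
  then show ?thesis
    unfolding isomorphic_cats_def cat_iso_def using assms by auto
qed

lemma lax_slice_simps:
  "Ob (lax_slice I A F) = {(X, \<mu>). pseudo_cone I A F X \<mu>}"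
  "Mo (lax_slice I A F) = {p. lax_slice_mor I A F p}"
  "Ce (lax_slice I A F) = {\<theta>. lax_slice_cell I A F \<theta>}"
  "src (lax_slice I A F) = lsrc" "trg (lax_slice I A F) = ltrg"
  "dom2 (lax_slice I A F) = ldom" "cod2 (lax_slice I A F) = lcod"
  "id2 (lax_slice I A F) p = \<lparr> ldom = p, lcod = p, lce = id2 A (lmo p) \<rparr>"
  "vcomp (lax_slice I A F) \<beta> \<alpha> = \<lparr> ldom = ldom \<alpha>, lcod = lcod \<beta>, lce = vcomp A (lce \<beta>) (lce \<alpha>) \<rparr>"
  by (simp_all add: lax_slice_def)

lemma comp1_Ps: "comp1 (Ps I A) = ptrans_comp I A"
  by (simp add: Ps_def)

text \<open>The 1-morphism into L is unique, the modification exists and is unique by thinness, and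
  its only endomorphism in the slice is the identity.\<close>

lemma hom_lax_slice_terminal:
  assumes h: "apex x h"
  shows "isomorphic_cats
    (hom_cat (lax_slice cospan ex_two_cat ex_diagram) (x, cone x h) (oL, cone oL False)) terminal_cat"
proof -
  let ?S = "lax_slice cospan ex_two_cat ex_diagram"
  \<comment> \<open>The source decides whether a morphism into L contains \<open>f\<close>: the
    generator from X, the identity from L.\<close>
  define f where "f = em x oL (x = oX)"
  have a: "arrow x oL (x = oX)"
    using h by (auto simp: apex_def arrow_def)
  have f: "mor ex_two_cat g x oL \<longleftrightarrow> g = f" for g
    using h by (auto simp: mor_ex f_def apex_def arrow_def)
  have ff: "cell ex_two_cat (id2 ex_two_cat f) f f"
    unfolding f_def by (rule E.id2_cell[OF em_Mo[OF a]])
  have comp: "ptrans_comp cospan ex_two_cat (cone oL False) (Delta_mor cospan ex_two_cat f) =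
      cone x (x = oX)"
    unfolding f_def by (rule ptrans_comp_cone[OF a])
  \<comment> \<open>The composite with \<lambda> contains \<open>f\<close> whenever the given cone
    does, which is the condition for a modification between them.\<close>
  have "apex x (x = oX)" "h \<longrightarrow> x = oX"
    using h by (auto simp: apex_def)
  then obtain \<phi> where \<phi>: "modification cospan ex_two_cat \<phi>" "msrc \<phi> = cone x (x = oX)"
    "mtrg \<phi> = cone x h"
    using ex_modification[OF _ h] by blast
  have uniq: "cell (Ps cospan ex_two_cat) \<psi> (cone x (x = oX)) (cone x h) \<longleftrightarrow> \<psi> = \<phi>" for \<psi>
    unfolding cell_Ps using \<phi> modification_eqI[of \<psi> \<phi>] by auto
  define p where "p = \<lparr> lsrc = (x, cone x h), ltrg = (oL, cone oL False), lmo = f, lmod = \<phi> \<rparr>"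
  have p: "lsrc p = (x, cone x h)" "ltrg p = (oL, cone oL False)" "lmo p = f" "lmod p = \<phi>"
    by (simp_all add: p_def)
  have cones: "pseudo_cone cospan ex_two_cat ex_diagram x (cone x h)"
    "pseudo_cone cospan ex_two_cat ex_diagram oL (cone oL False)"
    using h by (auto simp: pseudo_cone_iff apex_def)
  have M: "mor ?S q (x, cone x h) (oL, cone oL False) \<longleftrightarrow> q = p" for q
  proof
    assume "mor ?S q (x, cone x h) (oL, cone oL False)"
    then have q: "lax_slice_mor cospan ex_two_cat ex_diagram q" "lsrc q = lsrc p" "ltrg q = ltrg p"
      by (simp_all add: mor_def lax_slice_simps p)
    then have "lmo q = f"
      by (simp add: lax_slice_mor_def p f)
    moreover have "lmod q = \<phi>"
      using q calculation by (simp add: lax_slice_mor_def p comp1_Ps comp uniq)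
    ultimately show "q = p"
      using q by (simp add: p)
  next
    assume "q = p"
    then show "mor ?S q (x, cone x h) (oL, cone oL False)"
      using cones f uniq by (simp add: mor_def[of ?S] lax_slice_simps lax_slice_mor_def p comp1_Ps comp)
  qed
  define a where "a = \<lparr> ldom = p, lcod = p, lce = id2 ex_two_cat f \<rparr>"
  have C: "\<theta> \<in> Ce ?S \<and> ldom \<theta> = p \<and> lcod \<theta> = p \<longleftrightarrow> \<theta> = a" for \<theta>
  proof
    assume \<theta>: "\<theta> \<in> Ce ?S \<and> ldom \<theta> = p \<and> lcod \<theta> = p"
    then have "lax_slice_cell cospan ex_two_cat ex_diagram \<theta>" "ldom \<theta> = p" "lcod \<theta> = p"
      by (simp_all add: lax_slice_simps)
    then have "cell ex_two_cat (lce \<theta>) f f"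
      by (simp add: lax_slice_cell_def p)
    from cell_thin[OF this ff] \<theta> show "\<theta> = a"
      by (simp add: a_def)
  next
    assume "\<theta> = a"
    interpret \<phi>: modification cospan ex_two_cat \<phi> by fact
    \<comment> \<open>The slice condition for the identity, componentwise: whiskering \<lambda> with
      an identity gives an identity, which composes away.\<close>
    have "vcomp ex_two_cat (mob \<phi> i) (hcomp ex_two_cat (id2 ex_two_cat (em oL (ex_fob i) False))
        (id2 ex_two_cat f)) = mob \<phi> i" for i
    proof -
      have "arrow oL (ex_fob i) False"
        by (rule apex_arrow) (simp add: apex_def)
      from hcomp_id2_em[OF \<open>arrow x oL (x = oX)\<close> this] E.vcomp_id2[OF \<phi>.mob[of i]]
      show ?thesis by (simp add: f_def \<phi>(2) cone_def)
    qed
    then have "vcomp (Ps cospan ex_two_cat) \<phi>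
        (lwhisk (Ps cospan ex_two_cat) (cone oL False) (Delta_cell cospan ex_two_cat
          (id2 ex_two_cat f))) = \<phi>"
      using ff comp \<phi>
      by (intro modif.equality)
        (simp_all add: Ps_def lwhisk_def Delta_cell_def cell_def cone_def[of oL] restrict_def)
    moreover have "lax_slice_mor cospan ex_two_cat ex_diagram p"
      using M[of p] by (simp add: mor_def lax_slice_simps)
    ultimately show "\<theta> \<in> Ce ?S \<and> ldom \<theta> = p \<and> lcod \<theta> = p"
      using ff \<open>\<theta> = a\<close> by (simp add: lax_slice_simps lax_slice_cell_def a_def p)
  qed
  show ?thesis
  proof (rule isomorphic_terminal_cat[of _ p a])
    let ?H = "hom_cat ?S (x, cone x h) (oL, cone oL False)"
    show "cobj ?H = {p}"
      by (simp add: hom_cat_def M)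
    show "carr ?H = {a}"
      using C by (auto simp: hom_cat_def M lax_slice_simps(6,7))
    show "cdom ?H a = p" "ccod ?H a = p"
      by (simp_all add: hom_cat_def lax_slice_simps a_def)
    show "cid ?H p = a"
      by (simp add: hom_cat_def lax_slice_simps a_def p)
    show "ccomp ?H a a = a"
      using E.vcomp_id2[OF ff] by (simp add: hom_cat_def lax_slice_simps a_def)
  qed
qed

lemma not_pseudo_limit_ex: "\<not> pseudo_limit cospan ex_two_cat ex_diagram oL (cone oL False)"
proof
  assume "pseudo_limit cospan ex_two_cat ex_diagram oL (cone oL False)"
  then have "cat_iso (hom_cat ex_two_cat oX oL)
      (hom_cat (Ps cospan ex_two_cat) (Delta_ob cospan ex_two_cat oX) ex_diagram)
      (\<lambda>f. comp1 (Ps cospan ex_two_cat) (cone oL False) (Delta_mor cospan ex_two_cat f))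
      (\<lambda>\<alpha>. lwhisk (Ps cospan ex_two_cat) (cone oL False) (Delta_cell cospan ex_two_cat \<alpha>))"
    by (simp add: pseudo_limit_def Ob_ex)
  then obtain G0 G1 where G: "cat_functor
      (hom_cat (Ps cospan ex_two_cat) (Delta_ob cospan ex_two_cat oX) ex_diagram)
      (hom_cat ex_two_cat oX oL) G0 G1"
    and FG: "\<And>\<mu>. mor (Ps cospan ex_two_cat) \<mu> (Delta_ob cospan ex_two_cat oX) ex_diagram \<Longrightarrow>
      ptrans_comp cospan ex_two_cat (cone oL False) (Delta_mor cospan ex_two_cat (G0 \<mu>)) = \<mu>"
    unfolding cat_iso_def by (auto simp: hom_cat_def comp1_Ps)
  \<comment> \<open>The cone \<alpha>; an inverse of the comparison functor at X would factor it
    through \<lambda>.\<close>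
  let ?\<mu> = "cone oX False"
  have \<mu>: "mor (Ps cospan ex_two_cat) ?\<mu> (Delta_ob cospan ex_two_cat oX) ex_diagram"
    using pseudonatural_cone[of oX False] by (simp add: mor_Ps apex_def, simp add: cone_def)
  then have "mor ex_two_cat (G0 ?\<mu>) oX oL"
    using cat_functor.map_obj[OF G, of ?\<mu>] by (simp add: hom_cat_def)
  then obtain k where k: "arrow oX oL k" "G0 ?\<mu> = em oX oL k"
    by (auto simp: mor_ex)
  \<comment> \<open>The factor can only be \<open>f\<close>, so the factorization yields
    \<open>\<lambda> \<Delta>f\<close> in place of \<alpha>. These differ already in their legs to
    B.\<close>
  then have "cone oX True = ?\<mu>"
    using FG[OF \<mu>] ptrans_comp_cone[OF k(1)] by (simp add: arrow_def)
  then have "em oX oB True = em oX oB False"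
    by (auto simp: cone_def fun_eq_iff dest: spec[of _ Left])
  then show False
    by (simp add: em_eq_iff arrow_def)
qed

theorem mainTheorem16:
  shows "(\<forall>\<theta> \<in> Ce ex_two_cat. invertible2 ex_two_cat \<theta> \<longrightarrow>
            (\<exists>g \<in> Mo ex_two_cat. \<theta> = id2 ex_two_cat g)) \<and>
         two_terminal (lax_slice cospan ex_two_cat ex_diagram) (oL, ex_cone) \<and>
         \<not> pseudo_limit cospan ex_two_cat ex_diagram oL ex_cone"
proof (intro conjI ballI impI)
  fix \<theta> assume "\<theta> \<in> Ce ex_two_cat" "invertible2 ex_two_cat \<theta>"
  then show "\<exists>g \<in> Mo ex_two_cat. \<theta> = id2 ex_two_cat g"
    using invertible2_ex[of \<theta>] E.cell[of \<theta>] by (auto simp: cell_def mor_def)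
next
  show "two_terminal (lax_slice cospan ex_two_cat ex_diagram) (oL, ex_cone)"
    unfolding two_terminal_def ex_cone_eq
    using hom_lax_slice_terminal by (auto simp: lax_slice_simps pseudo_cone_iff apex_def)
next
  show "\<not> pseudo_limit cospan ex_two_cat ex_diagram oL ex_cone"
    unfolding ex_cone_eq by (rule not_pseudo_limit_ex)
qed

end
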